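(* Let $G$ be a connected bipartite $k$-regular graph, where $k\geqslant 3$. If $R(G)>\sqrt{k-2}$, then $R(G)=\sqrt{k-1}$ and $G$ is the incidence graph of a projective plane of order $k-1$.
   Context: All graphs are simple (no loops or multiple edges). For a graph $G$ of order $n$ with adjacency eigenvalues $\lambda_1\geqslant\cdots\geqslant\lambda_n$, the HL-index is $R(G)=\max\{|\lambda_{\lfloor (n+1)/2\rfloor}|,\ |\lambda_{\lceil (n+1)/2\rceil}|\}$. The incidence graph of a projective plane is the bipartite graph whose two parts are the points and the lines of the plane, a point being adjacent to a line iff it lies on it. *)

theory Defs
  imports "Jordan_Normal_Form.Char_Poly" "HOL-Library.Multiset"
begin

definition simple_graph :: "nat \<Rightarrow> (nat \<Rightarrow> nat \<Rightarrow> bool) \<Rightarrow> bool" where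
  "simple_graph n E \<longleftrightarrow> (\<forall>u<n. \<forall>v<n. E u v \<longleftrightarrow> E v u) \<and> (\<forall>v<n. \<not> E v v)"

definition connected_graph :: "nat \<Rightarrow> (nat \<Rightarrow> nat \<Rightarrow> bool) \<Rightarrow> bool" where
  "connected_graph n E \<longleftrightarrow> 0 < n \<and>
     (\<forall>u<n. \<forall>v<n. (\<lambda>x y. x < n \<and> y < n \<and> E x y)\<^sup>*\<^sup>* u v)"

definition bipartite_graph :: "nat \<Rightarrow> (nat \<Rightarrow> nat \<Rightarrow> bool) \<Rightarrow> bool" where
  "bipartite_graph n E \<longleftrightarrow> (\<exists>A. \<forall>u<n. \<forall>v<n. E u v \<longrightarrow> (u \<in> A \<longleftrightarrow> v \<notin> A))"

definition regular_graph :: "nat \<Rightarrow> (nat \<Rightarrow> nat \<Rightarrow> bool) \<Rightarrow> nat \<Rightarrow> bool" where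
  "regular_graph n E k \<longleftrightarrow> (\<forall>v<n. card {u. u < n \<and> E v u} = k)"

definition adjacency_matrix :: "nat \<Rightarrow> (nat \<Rightarrow> nat \<Rightarrow> bool) \<Rightarrow> real mat" where
  "adjacency_matrix n E = mat n n (\<lambda>(i, j). if E i j then 1 else 0)"

text \<open>The eigenvalues of a real matrix whose characteristic polynomial splits over the
  reals (e.g. a real symmetric matrix), listed with multiplicity in non-increasing order:
  lambda_1 >= ... >= lambda_n.\<close>

definition eigenvalues_desc :: "real mat \<Rightarrow> real list" where
  "eigenvalues_desc A = (THE xs. sorted (rev xs) \<and> length xs = dim_row A \<and>
      char_poly A = (\<Prod>a\<leftarrow>xs. [:- a, 1:]))"

definition graph_eigenvalue :: "nat \<Rightarrow> (nat \<Rightarrow> nat \<Rightarrow> bool) \<Rightarrow> nat \<Rightarrow> real" where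
  "graph_eigenvalue n E i = eigenvalues_desc (adjacency_matrix n E) ! (i - 1)"

definition HL_index :: "nat \<Rightarrow> (nat \<Rightarrow> nat \<Rightarrow> bool) \<Rightarrow> real" where
  "HL_index n E = max \<bar>graph_eigenvalue n E ((n + 1) div 2)\<bar>
                      \<bar>graph_eigenvalue n E ((n + 2) div 2)\<bar>"

definition projective_plane :: "'p set \<Rightarrow> 'l set \<Rightarrow> ('p \<Rightarrow> 'l \<Rightarrow> bool) \<Rightarrow> bool" where
  "projective_plane P L I \<longleftrightarrow>
     (\<forall>p\<in>P. \<forall>q\<in>P. p \<noteq> q \<longrightarrow> (\<exists>!l. l \<in> L \<and> I p l \<and> I q l)) \<and>
     (\<forall>l\<in>L. \<forall>m\<in>L. l \<noteq> m \<longrightarrow> (\<exists>!p. p \<in> P \<and> I p l \<and> I p m)) \<and>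
     (\<exists>S \<subseteq> P. card S = 4 \<and> (\<forall>l\<in>L. card {p \<in> S. I p l} \<le> 2))"

definition projective_plane_of_order :: "'p set \<Rightarrow> 'l set \<Rightarrow> ('p \<Rightarrow> 'l \<Rightarrow> bool) \<Rightarrow> nat \<Rightarrow> bool" where
  "projective_plane_of_order P L I q \<longleftrightarrow> projective_plane P L I \<and> finite P \<and> finite L \<and>
     (\<forall>l\<in>L. card {p \<in> P. I p l} = q + 1)"

fun incidence_adj :: "('p \<Rightarrow> 'l \<Rightarrow> bool) \<Rightarrow> 'p + 'l \<Rightarrow> 'p + 'l \<Rightarrow> bool" where
  "incidence_adj I (Inl p) (Inr l) = I p l"
| "incidence_adj I (Inr l) (Inl p) = I p l"
| "incidence_adj I _ _ = False"

definition is_incidence_graph_of_projective_plane :: "nat \<Rightarrow> (nat \<Rightarrow> nat \<Rightarrow> bool) \<Rightarrow> nat \<Rightarrow> bool" where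
  "is_incidence_graph_of_projective_plane n E q \<longleftrightarrow>
     (\<exists>(P :: nat set) (L :: nat set) I (f :: nat \<Rightarrow> nat + nat).
        projective_plane_of_order P L I q \<and>
        bij_betw f {0..<n} (Inl ` P \<union> Inr ` L) \<and>
        (\<forall>u<n. \<forall>v<n. E u v \<longleftrightarrow> incidence_adj I (f u) (f v)))"

end

theory Submission
  imports Defs "HOL-Analysis.Function_Topology"
begin

text \<open>The spectrum is symmetric about 0, so \<open>R(G)\<close> is the least absolute value of an eigenvalue and
  \<open>A\<^sup>2 - (k - 2) I\<close> is positive definite. Its entries are numbers of common neighbours, hence any two
  vertices have at most one common neighbour and \<open>A\<^sup>2 - (k - 2) I = 2I + B\<close>, where \<open>B\<close> is the
  adjacency matrix of the relation of being at distance two. Integral null vectors of \<open>2I + B\<close>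
  exclude configurations of \<open>B\<close>: nonadjacent \<open>p\<close> and \<open>r\<close> cannot have three common neighbours, because
  then at most three vertices could be adjacent to exactly one of them, and two common neighbours
  are excluded by a parity argument. So every neighbourhood in \<open>B\<close> is a disjoint union of cliques,
  which must be a single clique, and by connectedness \<open>B\<close> is complete on each side of the
  bipartition. Then \<open>A\<^sup>2 = (k - 1) I + J\<close> on each side.\<close>

section \<open>Eigenvalues of symmetric matrices\<close>

text \<open>The threshold k - 2 is what turns A^2 into 2I + B: the vertices become linearly
  independent vectors of norm 2 with inner products 0 or 1. Each forbidden configuration is refuted
  by one explicit integral dependence, such as p + r - a - b for an induced 4-cycle. With several
  common neighbours of p and r, unknown adjacencies stand in the way. They are absorbed into signs:
  projecting away p, r and the common neighbours leaves vectors whose inner products are fixed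
  modulo 4 by the signs and bounded by Cauchy-Schwarz. With two common neighbours this yields a
  consistent sign pattern but no contradiction yet; that comes from incidence arguments, reading one
  side of the bipartition as points and the other as lines. For the value of R, the vector e_p - e_q
  with p and q at distance two shows R^2 <= k - 1; an eigenvector within that bound is annihilated
  by J, so the square of its eigenvalue is k - 1.\<close>

lemma symmetric_form_minimizer:
  fixes S :: "nat \<Rightarrow> nat \<Rightarrow> real"
  assumes "0 < n" and sym: "\<And>i j. i < n \<Longrightarrow> j < n \<Longrightarrow> S i j = S j i"
  obtains x \<mu> where "\<exists>i<n. x i \<noteq> 0" "\<And>i. i < n \<Longrightarrow> (\<Sum>j<n. S i j * x j) = \<mu> * x i"
    "\<And>y. \<mu> * (\<Sum>i<n. (y i)\<^sup>2) \<le> (\<Sum>i<n. y i * (\<Sum>j<n. S i j * y j))"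
proof -
  define q where "q y = (\<Sum>i<n. y i * (\<Sum>j<n. S i j * y j))" for y :: "nat \<Rightarrow> real"
  define N where "N y = (\<Sum>i<n. (y i)\<^sup>2)" for y :: "nat \<Rightarrow> real"
  \<comment> \<open>Vectors are functions on all naturals; pinning the coordinates from
    \<open>n\<close> on to 0 makes the constraint N = 1 one on finitely many bounded
    coordinates.\<close>
  let ?box = "PiE UNIV (\<lambda>i. if i < n then {-1..1} else {0::real})"
  have cN: "continuous_on A N" and cq: "continuous_on A q" for A
    unfolding N_def q_def
    by (intro continuous_intros continuous_on_subset[OF continuous_on_product_coordinates subset_UNIV])+
  have "compact ?box"
    using compactin_PiE[of "\<lambda>_::nat. (euclidean :: real topology)" UNIV "\<lambda>i. if i < n then {-1..1} else {0}"]
    unfolding euclidean_product_topology by (auto simp: compactin_euclidean_iff)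
  moreover have "closed {x. N x = 1}"
    using closed_Collect_eq[of N "\<lambda>_. 1"] cN by simp
  ultimately have cmp: "compact (?box \<inter> {x. N x = 1})" by (rule compact_Int_closed)
  have "(\<lambda>i. if i = 0 then 1 else 0) \<in> ?box \<inter> {x. N x = 1}"
    using \<open>0 < n\<close> by (auto simp: N_def if_distrib[of "\<lambda>a. a\<^sup>2"] cong: if_cong)
  then obtain x where x: "x \<in> ?box" "N x = 1"
    and xmin: "\<And>y. y \<in> ?box \<Longrightarrow> N y = 1 \<Longrightarrow> q x \<le> q y"
    using continuous_attains_inf[OF cmp _ cq] by blast
  have low: "q x * N y \<le> q y" for y
  proof (cases "N y = 0")
    case True
    then have "y i = 0" if "i < n" for i
      using that unfolding N_def by (subst (asm) sum_nonneg_eq_0_iff) auto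
    then show ?thesis by (simp add: True q_def)
  next
    case False
    then have pos: "N y > 0" unfolding N_def
      by (metis less_eq_real_def sum_nonneg zero_le_power2)
    define z where "z i = (if i < n then y i / sqrt (N y) else 0)" for i
    have Nz: "N z = 1"
    proof -
      have "N z = (\<Sum>i<n. (y i)\<^sup>2 / N y)" unfolding N_def z_def
        by (rule sum.cong) (use pos in \<open>auto simp: power_divide N_def[symmetric]\<close>)
      then show ?thesis using pos by (simp add: sum_divide_distrib[symmetric] N_def[symmetric])
    qed
    have qz: "q z = q y / N y"
    proof -
      have "q z = (\<Sum>i<n. (y i / sqrt (N y)) * (\<Sum>j<n. S i j * (y j / sqrt (N y))))"
        unfolding q_def z_def by (intro sum.cong refl arg_cong2[of _ _ _ _ "(*)"]) auto
      also have "\<dots> = (\<Sum>i<n. (y i * (\<Sum>j<n. S i j * y j)) / N y)"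
        using pos by (intro sum.cong refl) (simp add: sum_divide_distrib[symmetric])
      finally show ?thesis by (simp add: sum_divide_distrib[symmetric] q_def)
    qed
    have "\<bar>z i\<bar> \<le> 1" if "i < n" for i
    proof -
      have "(z i)\<^sup>2 \<le> N z" unfolding N_def
        by (rule member_le_sum) (use that in auto)
      then show ?thesis using Nz by (simp add: abs_le_square_iff[of _ 1, simplified])
    qed
    then have "z i \<in> (if i < n then {-1..1} else {0})" for i
    by (cases "i < n") (fastforce simp: abs_le_iff, simp add: z_def)
  then have "z \<in> ?box" by blast
  from xmin[OF this Nz] show ?thesis using pos by (simp add: qz field_simps)
  qed
  \<comment> \<open>First variation: at x + t e_i the difference \<open>q y - q x * N y\<close> is
    2tb + t^2 c. It is nonnegative by \<open>low\<close>, which forces b = 0.\<close>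
  have "(\<Sum>j<n. S i j * x j) = q x * x i" if i: "i < n" for i
  proof -
    define b where "b = (\<Sum>j<n. S i j * x j) - q x * x i"
    define c where "c = S i i - q x"
    have "0 \<le> 2 * t * b + t\<^sup>2 * c" for t
    proof -
      define y where "y j = x j + (if j = i then t else 0)" for j
      have Sy: "(\<Sum>j<n. S l j * y j) = (\<Sum>j<n. S l j * x j) + S l i * t" if "l < n" for l
      proof -
        have "(\<Sum>j<n. S l j * y j) = (\<Sum>j<n. S l j * x j + (if j = i then S l i * t else 0))"
          by (intro sum.cong) (auto simp: y_def distrib_left)
        then show ?thesis using i by (simp add: sum.distrib)
      qed
      have "q y = (\<Sum>l<n. x l * (\<Sum>j<n. S l j * y j)) + t * (\<Sum>j<n. S i j * y j)"
      proof -
        have "q y = (\<Sum>l<n. x l * (\<Sum>j<n. S l j * y j)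
            + (if l = i then t * (\<Sum>j<n. S i j * y j) else 0))"
          unfolding q_def by (intro sum.cong) (auto simp: y_def distrib_right)
        then show ?thesis using i by (simp add: sum.distrib)
      qed
      also have "(\<Sum>l<n. x l * (\<Sum>j<n. S l j * y j)) = q x + (\<Sum>l<n. x l * (S l i * t))"
        unfolding q_def by (simp add: Sy distrib_left sum.distrib)
      also have "(\<Sum>l<n. x l * (S l i * t)) = t * (\<Sum>j<n. S i j * x j)"
        unfolding sum_distrib_left using i by (intro sum.cong) (auto simp: sym)
      finally have qy: "q y = q x + 2 * t * (\<Sum>j<n. S i j * x j) + t\<^sup>2 * S i i"
        using Sy[OF i] by (simp add: algebra_simps power2_eq_square)
      have "N y = (\<Sum>l<n. (x l)\<^sup>2 + (if l = i then 2 * t * x i + t\<^sup>2 else 0))"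
        unfolding N_def y_def by (intro sum.cong) (auto simp: power2_sum)
      then have "N y = 1 + 2 * t * x i + t\<^sup>2"
        using i x(2) by (simp add: sum.distrib N_def)
      then show ?thesis using low[of y] qy unfolding b_def c_def by (simp add: algebra_simps)
    qed
    note quad = this
    have "b = 0"
    proof (rule ccontr)
      assume "b \<noteq> 0"
      \<comment> \<open>A step against b, short enough for the linear term to win: c < 2(|c| +
        1).\<close>
      let ?t = "- b / (\<bar>c\<bar> + 1)"
      have "2 * ?t * b + ?t\<^sup>2 * c = (b\<^sup>2 / (\<bar>c\<bar> + 1)\<^sup>2) * (c - 2 * (\<bar>c\<bar> + 1))"
        by (simp add: power2_eq_square divide_simps) (simp add: algebra_simps)
      also have "\<dots> < 0"
        using \<open>b \<noteq> 0\<close> by (intro mult_pos_neg divide_pos_pos) auto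
      finally show False using quad[of ?t] by simp
    qed
    then show ?thesis by (simp add: b_def)
  qed
  moreover have "\<exists>i<n. x i \<noteq> 0"
    using x(2) unfolding N_def by (metis (mono_tags, lifting) lessThan_iff power_zero_numeral sum.neutral zero_neq_one)
  moreover have "q x * (\<Sum>i<n. (y i)\<^sup>2) \<le> (\<Sum>i<n. y i * (\<Sum>j<n. S i j * y j))" for y
    using low[of y] by (simp add: N_def q_def)
  ultimately show ?thesis using that by blast
qed

lemma eigenvalue_iff_function:
  fixes A :: "'a :: field mat"
  assumes A: "A \<in> carrier_mat n n"
  shows "eigenvalue A \<mu> \<longleftrightarrow> (\<exists>x. (\<exists>i<n. x i \<noteq> 0) \<and> (\<forall>i<n. (\<Sum>j<n. A $$ (i, j) * x j) = \<mu> * x i))"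
proof
  assume "eigenvalue A \<mu>"
  then obtain v where v: "v \<in> carrier_vec n" "v \<noteq> 0\<^sub>v n" "A *\<^sub>v v = \<mu> \<cdot>\<^sub>v v"
    using A unfolding eigenvalue_def eigenvector_def by auto
  have "\<exists>i<n. v $ i \<noteq> 0"
  proof (rule ccontr)
    assume "\<not> (\<exists>i<n. v $ i \<noteq> 0)"
    then have "v = 0\<^sub>v n" using v(1) by (intro eq_vecI) auto
    then show False using v(2) by simp
  qed
  moreover have "(\<Sum>j<n. A $$ (i, j) * v $ j) = \<mu> * v $ i" if "i < n" for i
  proof -
    have "(A *\<^sub>v v) $ i = (\<Sum>j<n. A $$ (i, j) * v $ j)"
      using that A v(1) by (simp add: scalar_prod_def atLeast0LessThan)
    then show ?thesis using v that by simp
  qed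
  ultimately show "\<exists>x. (\<exists>i<n. x i \<noteq> 0) \<and> (\<forall>i<n. (\<Sum>j<n. A $$ (i, j) * x j) = \<mu> * x i)"
    by blast
next
  assume "\<exists>x. (\<exists>i<n. x i \<noteq> 0) \<and> (\<forall>i<n. (\<Sum>j<n. A $$ (i, j) * x j) = \<mu> * x i)"
  then obtain x i where x: "i < n" "x i \<noteq> 0" "\<And>i. i < n \<Longrightarrow> (\<Sum>j<n. A $$ (i, j) * x j) = \<mu> * x i"
    by blast
  have "A *\<^sub>v vec n x = \<mu> \<cdot>\<^sub>v vec n x"
    using A x(3) by (intro eq_vecI) (auto simp: scalar_prod_def atLeast0LessThan)
  moreover have "vec n x \<noteq> 0\<^sub>v n" using x(1,2) by (metis index_vec index_zero_vec(1))
  ultimately show "eigenvalue A \<mu>"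
    using A unfolding eigenvalue_def eigenvector_def by (intro exI[of _ "vec n x"]) auto
qed

text \<open>The Hermitian form of A at an eigenvector equals its own conjugate, and it is z times a
  positive norm.\<close>

lemma symmetric_eigenvalue_real:
  fixes A :: "real mat"
  assumes A: "A \<in> carrier_mat n n" and sym: "\<And>i j. i < n \<Longrightarrow> j < n \<Longrightarrow> A $$ (i, j) = A $$ (j, i)"
    and ev: "eigenvalue (map_mat complex_of_real A) z"
  shows "Im z = 0"
proof -
  let ?C = "map_mat complex_of_real A"
  from ev obtain v where v: "\<exists>i<n. v i \<noteq> 0"
    "\<And>i. i < n \<Longrightarrow> (\<Sum>j<n. ?C $$ (i, j) * v j) = z * v i"
    unfolding eigenvalue_iff_function[OF map_carrier_mat[THEN iffD2, OF A]] by blast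
  have row: "(\<Sum>j<n. complex_of_real (A $$ (i, j)) * v j) = z * v i" if "i < n" for i
    using v(2)[OF that] A that by simp
  define T where "T = (\<Sum>i<n. \<Sum>j<n. cnj (v i) * (complex_of_real (A $$ (i, j)) * v j))"
  define s where "s = (\<Sum>i<n. (cmod (v i))\<^sup>2)"
  have "T = (\<Sum>i<n. cnj (v i) * (z * v i))"
    unfolding T_def by (simp add: sum_distrib_left[symmetric] row)
  also have "\<dots> = z * complex_of_real s"
    unfolding s_def by (simp add: sum_distrib_left complex_norm_square mult_ac del: of_real_power)
  finally have T: "T = z * complex_of_real s" .
  have "cnj T = (\<Sum>i<n. \<Sum>j<n. cnj (v j) * (complex_of_real (A $$ (j, i)) * v i))"
    unfolding T_def by (simp, intro sum.cong refl) (auto simp: sym mult_ac)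
  also have "\<dots> = T" unfolding T_def by (rule sum.swap)
  finally have "Im T = 0" by (metis cnj.simps(2) equal_neg_zero)
  moreover have "s \<noteq> 0"
    using v(1) unfolding s_def by (subst sum_nonneg_eq_0_iff) auto
  ultimately show ?thesis by (simp add: T)
qed

lemma symmetric_char_poly_splits:
  fixes A :: "real mat"
  assumes A: "A \<in> carrier_mat n n" and sym: "\<And>i j. i < n \<Longrightarrow> j < n \<Longrightarrow> A $$ (i, j) = A $$ (j, i)"
  shows "\<exists>xs. length xs = n \<and> char_poly A = (\<Prod>a\<leftarrow>xs. [:- a, 1:])"
proof -
  interpret cpoly: map_poly_inj_idom_hom complex_of_real ..
  let ?C = "map_mat complex_of_real A"
  have C: "?C \<in> carrier_mat n n" using A by simp
  from char_poly_factorized[OF C] obtain as where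
    as: "char_poly ?C = (\<Prod>a\<leftarrow>as. [:- a, 1:])" "length as = n" by blast
  have real: "complex_of_real (Re a) = a" if "a \<in> set as" for a
  proof -
    have "poly (char_poly ?C) a = 0" unfolding as(1) using that
      by (auto simp: poly_prod_list prod_list_zero_iff)
    then have "eigenvalue ?C a" using eigenvalue_root_char_poly[OF C] by simp
    from symmetric_eigenvalue_real[OF A sym this] show ?thesis by (simp add: complex_eq_iff)
  qed
  have "map_poly complex_of_real (char_poly A) = char_poly ?C"
    by (rule of_real_hom.char_poly_hom[OF A, symmetric])
  also have "\<dots> = (\<Prod>a\<leftarrow>map Re as. [:- complex_of_real a, 1:])"
    unfolding as(1) by (simp add: o_def real cong: map_cong)
  also have "\<dots> = map_poly complex_of_real (\<Prod>a\<leftarrow>map Re as. [:- a, 1:])"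
    by (simp add: cpoly.hom_prod_list o_def of_real_hom.map_poly_pCons_hom)
  finally have "char_poly A = (\<Prod>a\<leftarrow>map Re as. [:- a, 1:])" by simp
  then show ?thesis using as(2) by (intro exI[of _ "map Re as"]) simp
qed

lemma proots_linear_factors:
  "proots (\<Prod>a\<leftarrow>xs. [:- a, 1:]) = mset (xs :: 'a :: idom list)"
proof (induction xs)
  case (Cons a xs)
  have "(\<Prod>a\<leftarrow>xs. [:- a, 1:]) \<noteq> 0" by (auto simp: prod_list_zero_iff)
  then show ?case using Cons by (simp add: proots_mult del: mult_pCons_left)
qed simp

lemma sorted_linear_factors_unique:
  fixes xs ys :: "'a :: {idom, linorder} list"
  assumes "sorted (rev xs)" "sorted (rev ys)"
    and "(\<Prod>a\<leftarrow>xs. [:- a, 1:]) = (\<Prod>a\<leftarrow>ys. [:- a, 1:])"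
  shows "xs = ys"
proof -
  have "mset (rev xs) = mset (rev ys)"
    using assms(3) by (metis mset_rev proots_linear_factors)
  then have "rev xs = rev ys"
    using assms(1,2) by (metis properties_for_sort)
  then show ?thesis by simp
qed

text \<open>Shows that the definite description denotes: a list exists because the polynomial
  splits, and sortedness makes it unique.\<close>

lemma eigenvalues_desc_symmetric:
  fixes A :: "real mat"
  assumes A: "A \<in> carrier_mat n n" and sym: "\<And>i j. i < n \<Longrightarrow> j < n \<Longrightarrow> A $$ (i, j) = A $$ (j, i)"
  shows "sorted (rev (eigenvalues_desc A))" "length (eigenvalues_desc A) = n"
    "char_poly A = (\<Prod>a\<leftarrow>eigenvalues_desc A. [:- a, 1:])"
proof -
  obtain xs where xs: "length xs = n" "char_poly A = (\<Prod>a\<leftarrow>xs. [:- a, 1:])"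
    using symmetric_char_poly_splits[OF A sym] by blast
  let ?P = "\<lambda>ys. sorted (rev ys) \<and> length ys = dim_row A \<and> char_poly A = (\<Prod>a\<leftarrow>ys. [:- a, 1:])"
  have "?P (rev (sort xs))"
  proof -
    have "(\<Prod>a\<leftarrow>rev (sort xs). [:- a, 1:]) = (\<Prod>a\<leftarrow>xs. [:- a, 1:])"
      unfolding prod_mset_prod_list[symmetric] mset_map by simp
    then show ?thesis using A xs by simp
  qed
  then have "\<exists>!ys. ?P ys" using sorted_linear_factors_unique by metis
  from theI'[OF this] show "sorted (rev (eigenvalues_desc A))" "length (eigenvalues_desc A) = n"
    "char_poly A = (\<Prod>a\<leftarrow>eigenvalues_desc A. [:- a, 1:])"
    using A unfolding eigenvalues_desc_def by auto
qed

lemma eigenvalues_desc_iff_eigenvalue: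
  fixes A :: "real mat"
  assumes A: "A \<in> carrier_mat n n" and sym: "\<And>i j. i < n \<Longrightarrow> j < n \<Longrightarrow> A $$ (i, j) = A $$ (j, i)"
  shows "\<mu> \<in> set (eigenvalues_desc A) \<longleftrightarrow> eigenvalue A \<mu>"
proof -
  have "eigenvalue A \<mu> \<longleftrightarrow> poly (\<Prod>a\<leftarrow>eigenvalues_desc A. [:- a, 1:]) \<mu> = 0"
    using eigenvalue_root_char_poly[OF A] eigenvalues_desc_symmetric(3)[OF A sym] by simp
  then show ?thesis by (auto simp: poly_prod_list prod_list_zero_iff)
qed

section \<open>Bipartite spectra and the median eigenvalues\<close>

lemma bipartite_char_poly_reflect:
  fixes A :: "real mat"
  assumes A: "A \<in> carrier_mat n n"
    and bip: "\<And>i j. i < n \<Longrightarrow> j < n \<Longrightarrow> A $$ (i, j) \<noteq> 0 \<Longrightarrow> (i \<in> S \<longleftrightarrow> j \<notin> S)"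
  shows "poly (char_poly A) (- x) = (- 1) ^ n * poly (char_poly A) x"
proof -
  \<comment> \<open>Flipping signs on one colour class negates every edge entry, so this involution
    conjugates A to -A.\<close>
  define P :: "real mat" where "P = mat n n (\<lambda>(i, j). if i = j then if i \<in> S then 1 else - 1 else 0)"
  have P: "P \<in> carrier_mat n n" by (simp add: P_def)
  have PP: "P * P = 1\<^sub>m n"
    by (rule eq_matI) (auto simp: P_def scalar_prod_def if_distrib[of "\<lambda>a. a * _"] cong: if_cong)
  have "P * (- A) * P = A"
  proof (rule eq_matI)
    fix i j assume "i < dim_row A" "j < dim_col A"
    then have ij: "i < n" "j < n" using A by auto
    have "(P * (- A)) $$ (i, l) = (if i \<in> S then - A $$ (i, l) else A $$ (i, l))" if "l < n" for l
      using ij that A by (simp add: P_def scalar_prod_def if_distrib[of "\<lambda>a. a * _"] cong: if_cong)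
    then have "(P * (- A) * P) $$ (i, j) =
        (if i \<in> S then - A $$ (i, j) else A $$ (i, j)) * (if j \<in> S then 1 else - 1)"
      using ij A by (simp add: P_def scalar_prod_def if_distrib[of "\<lambda>a. _ * a"] cong: if_cong)
    then show "(P * (- A) * P) $$ (i, j) = A $$ (i, j)"
      using bip[OF ij] by (cases "A $$ (i, j) = 0") auto
  qed (use A P in auto)
  then have "similar_mat A (- A)"
    unfolding similar_mat_def similar_mat_wit_def using A P PP by (intro exI[of _ P]) auto
  then have "poly (char_poly A) (- x) = det (- (char_matrix (- A) (- x)))"
    using char_poly_similar[of A "- A"] char_poly_matrix[of "- A" n "- x"] A by simp
  also have "- (char_matrix (- A) (- x)) = (- 1) \<cdot>\<^sub>m (- (char_matrix A x))"
    by (rule eq_matI) (use A in \<open>auto simp: char_matrix_def\<close>)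
  also have "det \<dots> = (- 1) ^ n * det (- (char_matrix A x))"
    using A by (simp add: char_matrix_def)
  finally show ?thesis by (simp add: char_poly_matrix[OF A])
qed

text \<open>Arguing with the polynomial keeps multiplicities: the negated, reversed list has the
  same linear factors and is sorted, so it is the list itself.\<close>

lemma bipartite_eigenvalues_symmetric:
  fixes A :: "real mat"
  assumes A: "A \<in> carrier_mat n n" and sym: "\<And>i j. i < n \<Longrightarrow> j < n \<Longrightarrow> A $$ (i, j) = A $$ (j, i)"
    and bip: "\<And>i j. i < n \<Longrightarrow> j < n \<Longrightarrow> A $$ (i, j) \<noteq> 0 \<Longrightarrow> (i \<in> S \<longleftrightarrow> j \<notin> S)"
    and i: "i < n"
  shows "eigenvalues_desc A ! (n - 1 - i) = - eigenvalues_desc A ! i"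
proof -
  define xs where "xs = eigenvalues_desc A"
  note xs = eigenvalues_desc_symmetric[OF A sym, folded xs_def]
  have pm: "prod_list (map uminus zs) = (- 1) ^ length zs * prod_list zs" for zs :: "real list"
    by (induction zs) auto
  have "poly (\<Prod>a\<leftarrow>rev (map uminus xs). [:- a, 1:]) x = poly (\<Prod>a\<leftarrow>xs. [:- a, 1:]) x" for x
  proof -
    have "poly (\<Prod>a\<leftarrow>rev (map uminus xs). [:- a, 1:]) x = (\<Prod>a\<leftarrow>xs. a + x)"
      unfolding prod_mset_prod_list[symmetric] mset_map mset_rev
      by (simp add: poly_prod_mset image_mset.compositionality o_def)
    also have "\<dots> = prod_list (map uminus (map (\<lambda>a. - a - x) xs))"
      by (simp add: o_def add.commute)
    also have "\<dots> = (- 1) ^ n * (\<Prod>a\<leftarrow>xs. - a - x)"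
      by (subst pm) (simp add: xs)
    also have "(\<Prod>a\<leftarrow>xs. - a - x) = poly (char_poly A) (- x)"
      by (simp add: xs(3) poly_prod_list o_def)
    also have "(- 1) ^ n * poly (char_poly A) (- x) = poly (char_poly A) x"
      by (simp add: bipartite_char_poly_reflect[OF A bip] flip: power_mult_distrib mult.assoc)
    finally show ?thesis by (simp add: xs(3))
  qed
  then have "(\<Prod>a\<leftarrow>rev (map uminus xs). [:- a, 1:]) = (\<Prod>a\<leftarrow>xs. [:- a, 1:])"
    by (intro poly_ext) simp
  moreover have "sorted (rev (rev (map uminus xs)))"
    using xs(1) by (simp add: sorted_wrt_rev sorted_map flip: sorted_wrt_map)
  ultimately have "rev (map uminus xs) = xs"
    using xs(1) sorted_linear_factors_unique by blast
  then have "xs ! (n - 1 - i) = rev (map uminus xs) ! (n - 1 - i)" by simp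
  also have "\<dots> = - xs ! i" using i xs(2) by (simp add: rev_nth)
  finally show ?thesis by (simp add: xs_def)
qed

text \<open>Does without an eigenbasis: the minimum of |Ay|^2 / |y|^2 is attained at an eigenvector
  of A^2, and it is the square of some eigenvalue of A.\<close>

lemma symmetric_norm_lower_bound:
  fixes A :: "real mat"
  assumes "0 < n" and A: "A \<in> carrier_mat n n"
    and sym: "\<And>i j. i < n \<Longrightarrow> j < n \<Longrightarrow> A $$ (i, j) = A $$ (j, i)"
    and "0 \<le> c" and ev: "\<And>\<mu>. eigenvalue A \<mu> \<Longrightarrow> c \<le> \<bar>\<mu>\<bar>"
  shows "c\<^sup>2 * (\<Sum>i<n. (y i)\<^sup>2) \<le> (\<Sum>i<n. (\<Sum>j<n. A $$ (i, j) * y j)\<^sup>2)"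
proof -
  define S where "S i j = (\<Sum>l<n. A $$ (i, l) * A $$ (l, j))" for i j
  define ap where "ap y i = (\<Sum>j<n. A $$ (i, j) * y j)" for y :: "nat \<Rightarrow> real" and i
  have Sap: "(\<Sum>j<n. S i j * y j) = ap (ap y) i" for y i
  proof -
    have "(\<Sum>j<n. S i j * y j) = (\<Sum>j<n. \<Sum>l<n. A $$ (i, l) * (A $$ (l, j) * y j))"
      by (simp add: S_def sum_distrib_right mult.assoc)
    also have "\<dots> = ap (ap y) i"
      unfolding ap_def sum_distrib_left by (rule sum.swap)
    finally show ?thesis .
  qed
  have form: "(\<Sum>i<n. y i * (\<Sum>j<n. S i j * y j)) = (\<Sum>i<n. (ap y i)\<^sup>2)" for y
  proof -
    have "(\<Sum>i<n. y i * ap (ap y) i) = (\<Sum>i<n. \<Sum>l<n. A $$ (l, i) * y i * ap y l)"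
      unfolding ap_def[of "ap y"] sum_distrib_left by (intro sum.cong) (auto simp: sym mult_ac)
    also have "\<dots> = (\<Sum>l<n. \<Sum>i<n. A $$ (l, i) * y i * ap y l)" by (rule sum.swap)
    also have "\<dots> = (\<Sum>i<n. (ap y i)\<^sup>2)"
      by (simp add: ap_def[of y] power2_eq_square sum_distrib_right)
    finally show ?thesis by (simp add: Sap)
  qed
  have "S i j = S j i" if "i < n" "j < n" for i j
    unfolding S_def using that by (intro sum.cong) (auto simp: sym)
  then obtain x \<mu> where x: "\<exists>i<n. x i \<noteq> 0" "\<And>i. i < n \<Longrightarrow> ap (ap x) i = \<mu> * x i"
    and low: "\<And>y. \<mu> * (\<Sum>i<n. (y i)\<^sup>2) \<le> (\<Sum>i<n. (ap y i)\<^sup>2)"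
    using symmetric_form_minimizer[OF \<open>0 < n\<close>, of S] unfolding form unfolding Sap by metis
  have "(\<Sum>i<n. (ap x i)\<^sup>2) = \<mu> * (\<Sum>i<n. (x i)\<^sup>2)"
    unfolding form[symmetric] Sap sum_distrib_left
    by (intro sum.cong) (auto simp: x(2) power2_eq_square)
  moreover have "(\<Sum>i<n. (x i)\<^sup>2) > 0"
    using x(1) by (auto intro!: sum_pos2)
  ultimately have "\<mu> \<ge> 0"
    by (metis linorder_not_less mult_neg_pos sum_nonneg zero_le_power2)
  define \<sigma> where "\<sigma> = sqrt \<mu>"
  have \<sigma>: "\<sigma> * \<sigma> = \<mu>" "\<sigma> \<ge> 0" using \<open>\<mu> \<ge> 0\<close> by (auto simp: \<sigma>_def)
  have eig: "eigenvalue A \<nu>" if "\<exists>i<n. z i \<noteq> 0" "\<And>i. i < n \<Longrightarrow> ap z i = \<nu> * z i" for \<nu> z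
    unfolding eigenvalue_iff_function[OF A] using that unfolding ap_def by blast
  \<comment> \<open>Since (A - sigma)(A + sigma) x = 0, either (A + sigma) x vanishes or it is an
    eigenvector for sigma.\<close>
  have "eigenvalue A (- \<sigma>) \<or> eigenvalue A \<sigma>"
  proof (cases "\<forall>i<n. ap x i = - \<sigma> * x i")
    case True
    then show ?thesis using eig[of x] x(1) by blast
  next
    case False
    define z where "z i = ap x i + \<sigma> * x i" for i
    have "ap z i = \<sigma> * z i" if "i < n" for i
    proof -
      have "ap z i = ap (ap x) i + \<sigma> * ap x i"
        unfolding ap_def[of z] ap_def[of "ap x"] ap_def[of x i] z_def
        by (simp add: distrib_left sum.distrib sum_distrib_left mult_ac)
      then show ?thesis using x(2)[OF that] by (simp add: z_def distrib_left \<sigma>(1)[symmetric])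
    qed
    moreover have "\<exists>i<n. z i \<noteq> 0" using False by (auto simp: z_def add_eq_0_iff2)
    ultimately show ?thesis using eig[of z] by blast
  qed
  then have "c \<le> \<sigma>" using ev[of \<sigma>] ev[of "- \<sigma>"] \<sigma>(2) by auto
  then have "c\<^sup>2 \<le> \<mu>" using \<open>0 \<le> c\<close> \<sigma> by (metis mult_mono power2_eq_square)
  then have "c\<^sup>2 * (\<Sum>i<n. (y i)\<^sup>2) \<le> \<mu> * (\<Sum>i<n. (y i)\<^sup>2)"
    by (intro mult_right_mono sum_nonneg) auto
  also have "\<dots> \<le> (\<Sum>i<n. (ap y i)\<^sup>2)" by (rule low)
  finally show ?thesis by (simp add: ap_def)
qed

text \<open>For odd order the middle eigenvalue is its own negative, so a positive index forces even
  order. The two medians are then opposite, and sortedness puts no eigenvalue nearer to 0.\<close>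

lemma HL_index_eigenvalue:
  assumes simple: "simple_graph n E" and bip: "bipartite_graph n E" and "0 < n"
    and pos: "0 < HL_index n E"
  shows "\<exists>\<mu>. eigenvalue (adjacency_matrix n E) \<mu> \<and> \<bar>\<mu>\<bar> = HL_index n E"
    and "eigenvalue (adjacency_matrix n E) \<mu> \<Longrightarrow> HL_index n E \<le> \<bar>\<mu>\<bar>"
proof -
  let ?A = "adjacency_matrix n E"
  define xs where "xs = eigenvalues_desc ?A"
  have A: "?A \<in> carrier_mat n n" by (simp add: adjacency_matrix_def)
  have sym: "?A $$ (i, j) = ?A $$ (j, i)" if "i < n" "j < n" for i j
    using simple that by (auto simp: adjacency_matrix_def simple_graph_def)
  obtain S where S': "\<forall>u<n. \<forall>v<n. E u v \<longrightarrow> (u \<in> S \<longleftrightarrow> v \<notin> S)"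
    using bip unfolding bipartite_graph_def by blast
  have S: "i \<in> S \<longleftrightarrow> j \<notin> S" if "i < n" "j < n" "?A $$ (i, j) \<noteq> 0" for i j
    using S' that by (simp add: adjacency_matrix_def split: if_splits)
  note xs = eigenvalues_desc_symmetric[OF A sym, folded xs_def]
  have refl: "xs ! (n - 1 - i) = - xs ! i" if "i < n" for i
    using bipartite_eigenvalues_symmetric[OF A sym S that] by (simp add: xs_def)
  have anti: "xs ! j \<le> xs ! i" if "i \<le> j" "j < n" for i j
    using xs(1,2) that by (simp add: sorted_rev_iff_nth_mono)
  have HL: "HL_index n E = max \<bar>xs ! ((n + 1) div 2 - 1)\<bar> \<bar>xs ! ((n + 2) div 2 - 1)\<bar>"
    by (simp add: HL_index_def graph_eigenvalue_def xs_def)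
  have "even n"
  proof (rule ccontr)
    assume "odd n"
    then obtain m where m: "n = 2 * m + 1" by (rule oddE)
    then have "xs ! m = 0" using refl[of m] by simp
    moreover have "(n + 1) div 2 - 1 = m" "(n + 2) div 2 - 1 = m" using m by auto
    ultimately show False using pos unfolding HL by simp
  qed
  then obtain m where m: "n = 2 * m" by (rule evenE)
  have "m > 0" using m \<open>0 < n\<close> by simp
  then have mid: "(n + 1) div 2 - 1 = m - 1" "(n + 2) div 2 - 1 = m" "n - 1 - (m - 1) = m" "m - 1 < n" "m < n"
    using m by auto
  have neg: "xs ! m = - xs ! (m - 1)" using refl[of "m - 1"] mid by simp
  then have "xs ! (m - 1) \<ge> 0" using anti[of "m - 1" m] mid by simp
  then have HL': "HL_index n E = xs ! (m - 1)" unfolding HL mid by (simp add: neg)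
  have "xs ! (m - 1) \<in> set xs" using xs(2) mid by simp
  then have "eigenvalue ?A (xs ! (m - 1))"
    using eigenvalues_desc_iff_eigenvalue[OF A sym] by (simp add: xs_def)
  then show "\<exists>\<mu>. eigenvalue ?A \<mu> \<and> \<bar>\<mu>\<bar> = HL_index n E"
    using HL' \<open>xs ! (m - 1) \<ge> 0\<close> by (intro exI[of _ "xs ! (m - 1)"]) simp
  assume "eigenvalue ?A \<mu>"
  then have "\<mu> \<in> set xs" using eigenvalues_desc_iff_eigenvalue[OF A sym] by (simp add: xs_def)
  then obtain i where i: "i < n" "\<mu> = xs ! i" using xs(2) by (metis in_set_conv_nth)
  show "HL_index n E \<le> \<bar>\<mu>\<bar>"
  proof (cases "i \<le> m - 1")
    case True
    then have "HL_index n E \<le> \<mu>" using anti[of i "m - 1"] mid i HL' by simp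
    then show ?thesis by simp
  next
    case False
    then have "\<mu> \<le> - HL_index n E" using anti[of m i] i HL' neg by simp
    then show ?thesis by simp
  qed
qed

section \<open>Graphs with least eigenvalue greater than -2\<close>

definition gram :: "('a \<Rightarrow> 'a \<Rightarrow> bool) \<Rightarrow> 'a \<Rightarrow> 'a \<Rightarrow> real" where
  "gram R u v = (if u = v then 2 else if R u v then 1 else 0)"

text \<open>With lists, a concrete dependence is a literal that the simplifier expands entry by
  entry. Vertices may repeat, hence the collected coefficient \<open>coef\<close>.\<close>

definition lform :: "('a \<Rightarrow> 'a \<Rightarrow> bool) \<Rightarrow> (real \<times> 'a) list \<Rightarrow> (real \<times> 'a) list \<Rightarrow> real" where
  "lform R xs ys = (\<Sum>x\<leftarrow>xs. \<Sum>y\<leftarrow>ys. fst x * fst y * gram R (snd x) (snd y))"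

definition coef :: "(real \<times> 'a) list \<Rightarrow> 'a \<Rightarrow> real" where
  "coef xs v = (\<Sum>x\<leftarrow>xs. if snd x = v then fst x else 0)"

definition smul :: "real \<Rightarrow> (real \<times> 'a) list \<Rightarrow> (real \<times> 'a) list" where
  "smul s xs = map (\<lambda>x. (s * fst x, snd x)) xs"

lemma coef_simps [simp]:
  "coef [] v = 0" "coef ((c, p) # xs) v = (if p = v then c else 0) + coef xs v"
  "coef (xs @ ys) v = coef xs v + coef ys v" "coef (smul s xs) v = s * coef xs v"
  by (auto simp: coef_def smul_def)
    (simp add: sum_list_const_mult[symmetric] o_def if_distrib cong: if_cong)

lemma snd_set_smul [simp]: "snd ` set (smul s xs) = snd ` set xs"
  by (force simp: smul_def)

lemma lform_Nil [simp]: "lform R [] ys = 0" "lform R xs [] = 0"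
  by (auto simp: lform_def)

lemma lform_append [simp]:
  "lform R (xs @ ys) zs = lform R xs zs + lform R ys zs"
  "lform R zs (xs @ ys) = lform R zs xs + lform R zs ys"
  by (auto simp: lform_def sum_list_addf)

lemma lform_smul [simp]:
  "lform R (smul s xs) ys = s * lform R xs ys" "lform R xs (smul s ys) = s * lform R xs ys"
  by (simp_all add: lform_def smul_def o_def sum_list_const_mult[symmetric] mult_ac)

definition lval :: "('a \<Rightarrow> 'a \<Rightarrow> bool) \<Rightarrow> (real \<times> 'a) list \<Rightarrow> 'a \<Rightarrow> real" where
  "lval R xs q = (\<Sum>x\<leftarrow>xs. fst x * gram R (snd x) q)"

lemma lval_simps [simp]:
  "lval R [] q = 0" "lval R ((c, p) # xs) q = c * gram R p q + lval R xs q"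
  by (simp_all add: lval_def)

lemma lform_Cons_right:
  "lform R xs ((d, q) # ys) = d * lval R xs q + lform R xs ys"
  by (simp add: lform_def lval_def sum_list_addf sum_list_const_mult[symmetric] mult_ac)

lemma lval_map_uminus: "lval R (map (\<lambda>x. (- g x, x)) K') z = - (\<Sum>x\<leftarrow>K'. g x * gram R x z)"
  by (simp add: lval_def o_def uminus_sum_list_map)

lemma sum_list_delta:
  "distinct xs \<Longrightarrow> (\<Sum>y\<leftarrow>xs. if y = x then d else 0) = (if x \<in> set xs then d else (0 :: real))"
  by (induction xs) auto

text \<open>Positive definiteness of 2I + R says that the least eigenvalue of the graph exceeds -2.
  Vectors are lists of (coefficient, vertex) pairs, whose concatenation is addition.\<close>

locale posdef_graph =
  fixes V :: "'a set" and R :: "'a \<Rightarrow> 'a \<Rightarrow> bool"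
  assumes sym: "R u v \<Longrightarrow> R v u"
    and irrefl: "\<not> R u u"
    and pd: "snd ` set xs \<subseteq> V \<Longrightarrow> v \<in> V \<Longrightarrow> coef xs v \<noteq> 0 \<Longrightarrow> 0 < lform R xs xs"
begin

lemma sym_iff: "R u v \<longleftrightarrow> R v u"
  using sym by blast

lemma gram_sym: "gram R u v = gram R v u"
  using sym by (auto simp: gram_def)

lemma lform_sym: "lform R xs ys = lform R ys xs"
proof -
  have "lform R ys xs = (\<Sum>y\<leftarrow>ys. \<Sum>x\<leftarrow>xs. fst x * fst y * gram R (snd x) (snd y))"
    unfolding lform_def by (intro arg_cong[of _ _ sum_list] map_cong refl)
      (simp add: mult_ac gram_sym)
  also have "\<dots> = (\<Sum>x\<leftarrow>xs. \<Sum>y\<leftarrow>ys. fst x * fst y * gram R (snd x) (snd y))"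
    by (induction xs) (auto simp: sum_list_addf)
  finally show ?thesis by (simp add: lform_def)
qed

text \<open>An induced 4-cycle has eigenvalue -2, with an eigenvector alternating in sign.\<close>

lemma common_neighbours_adjacent:
  assumes V: "p \<in> V" "r \<in> V" "a \<in> V" "b \<in> V" and "p \<noteq> r" "\<not> R p r" "a \<noteq> b"
    and R: "R p a" "R r a" "R p b" "R r b"
  shows "R a b"
proof (rule ccontr)
  assume "\<not> R a b"
  have ne: "p \<noteq> a" "r \<noteq> a" "p \<noteq> b" "r \<noteq> b" using R irrefl by auto
  let ?xs = "[(1, p), (1, r), (-1, a), (-1, b)]"
  have "lform R ?xs ?xs = 0"
    using assms ne \<open>\<not> R a b\<close> R[THEN sym] sym[of b a] sym[of r p]
    by (auto simp: lform_Cons_right gram_def)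
  moreover have "0 < lform R ?xs ?xs"
    by (rule pd[of _ p]) (use assms ne in auto)
  ultimately show False by simp
qed

text \<open>For \<open>y\<close> adjacent to exactly one of \<open>p\<close> and \<open>r\<close>,
  this is twice a coordinate of \<open>y\<close> in the orthonormal system described below: along x
  - e for a common neighbour \<open>x\<close>, along f for \<open>x\<close> =
  \<open>p\<close>.\<close>

definition sgn_adj :: "'a \<Rightarrow> 'a \<Rightarrow> real" where
  "sgn_adj x y = (if R x y then 1 else - 1)"

lemma sgn_adj_prod: "sgn_adj x y * sgn_adj x z = 1 \<or> sgn_adj x y * sgn_adj x z = - 1"
  by (auto simp: sgn_adj_def)

text \<open>Twice the component of \<open>y\<close> orthogonal to \<open>p\<close>, \<open>r\<close> and the common neighbours in \<open>K\<close>: together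
  with e = (p + r)/2 and f = (p - r)/2, the vectors x - e for x in \<open>K\<close> are orthonormal, and the
  coordinates of \<open>y\<close> with respect to all of them are 1/2 or -1/2.\<close>

definition residual :: "'a \<Rightarrow> 'a \<Rightarrow> 'a list \<Rightarrow> 'a \<Rightarrow> (real \<times> 'a) list" where
  "residual p r K y = (let s = (\<Sum>x\<leftarrow>K. sgn_adj x y) in
     (2, y) # ((s - 1 - sgn_adj p y) / 2, p) # ((s - 1 + sgn_adj p y) / 2, r)
       # map (\<lambda>x. (- sgn_adj x y, x)) K)"

definition private_nbrs :: "'a \<Rightarrow> 'a \<Rightarrow> 'a set" where
  "private_nbrs p r = {y \<in> V. R p y \<longleftrightarrow> \<not> R r y}"

end

section \<open>Projecting away a nonadjacent pair and its common neighbours\<close>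

locale nonadjacent_pair = posdef_graph +
  fixes p r :: 'a and K :: "'a list"
  assumes pr: "p \<in> V" "r \<in> V" "p \<noteq> r" "\<not> R p r"
    and K: "distinct K" "set K \<subseteq> V" "\<And>x. x \<in> set K \<Longrightarrow> R p x" "\<And>x. x \<in> set K \<Longrightarrow> R r x"
    and Kclique: "\<And>x x'. x \<in> set K \<Longrightarrow> x' \<in> set K \<Longrightarrow> x \<noteq> x' \<Longrightarrow> R x x'"
begin

abbreviation c :: "'a \<Rightarrow> (real \<times> 'a) list" where "c \<equiv> residual p r K"
abbreviation Y :: "'a set" where "Y \<equiv> private_nbrs p r"

lemma YD:
  assumes "y \<in> Y"
  shows "y \<in> V" "y \<noteq> p" "y \<noteq> r" "y \<notin> set K"
    "R p y \<longleftrightarrow> sgn_adj p y = 1" "R r y \<longleftrightarrow> sgn_adj p y = - 1"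
  using assms pr K(3,4) sym irrefl by (auto simp: private_nbrs_def sgn_adj_def)

text \<open>The coefficients at \<open>p\<close> and \<open>r\<close> regroup as (s - 1) e -
  \<open>sgn_adj p y\<close> f: subtracting the multiples of x - e returns s times e, where s is the
  sum of the signs.\<close>

lemma lval_residual:
  "lval R (c y) z = 2 * gram R y z
     + ((\<Sum>x\<leftarrow>K. sgn_adj x y) - 1) / 2 * (gram R p z + gram R r z)
     - sgn_adj p y / 2 * (gram R p z - gram R r z)
     - (\<Sum>x\<leftarrow>K. sgn_adj x y * gram R x z)"
  unfolding residual_def Let_def
  by (simp add: lval_map_uminus field_simps)

lemma residual_p: assumes "y \<in> Y" shows "lval R (c y) p = 0"
proof -
  have "(\<Sum>x\<leftarrow>K. sgn_adj x y * gram R x p) = (\<Sum>x\<leftarrow>K. sgn_adj x y)"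
    by (intro arg_cong[of _ _ sum_list] map_cong refl) (use pr irrefl K(3)[THEN sym] in \<open>auto simp: gram_def\<close>)
  moreover have "gram R y p = (1 + sgn_adj p y) / 2" "gram R p p = 2" "gram R r p = 0"
    using YD[OF assms] pr by (auto simp: gram_def sgn_adj_def sym_iff[of y p] sym_iff[of r p])
  ultimately show ?thesis unfolding lval_residual by (simp add: field_simps)
qed

lemma residual_r: assumes "y \<in> Y" shows "lval R (c y) r = 0"
proof -
  have "(\<Sum>x\<leftarrow>K. sgn_adj x y * gram R x r) = (\<Sum>x\<leftarrow>K. sgn_adj x y)"
    by (intro arg_cong[of _ _ sum_list] map_cong refl) (use pr irrefl K(4)[THEN sym] in \<open>auto simp: gram_def\<close>)
  moreover have "gram R y r = (1 - sgn_adj p y) / 2" "gram R r r = 2" "gram R p r = 0"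
    using YD[OF assms] pr by (auto simp: gram_def sgn_adj_def sym_iff[of y r] split: if_splits)
  ultimately show ?thesis unfolding lval_residual by (simp add: field_simps)
qed

lemma residual_K: assumes "y \<in> Y" "x \<in> set K" shows "lval R (c y) x = 0"
proof -
  have "(\<Sum>x'\<leftarrow>K. sgn_adj x' y * gram R x' x) = (\<Sum>x'\<leftarrow>K. sgn_adj x' y + (if x' = x then sgn_adj x y else 0))"
    by (intro arg_cong[of _ _ sum_list] map_cong refl) (use Kclique assms(2) in \<open>auto simp: gram_def\<close>)
  also have "\<dots> = (\<Sum>x'\<leftarrow>K. sgn_adj x' y) + sgn_adj x y"
    using sum_list_delta[OF K(1)] assms(2) by (simp add: sum_list_addf)
  moreover have "gram R y x = (1 + sgn_adj x y) / 2" "gram R r x = 1" "gram R p x = 1"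
    using YD(4)[OF assms(1)] K(3,4)[OF assms(2)] assms(2) irrefl by (auto simp: gram_def sgn_adj_def sym_iff[of y x])
  ultimately show ?thesis unfolding lval_residual by (simp add: field_simps)
qed

text \<open>The first residual is orthogonal to \<open>p\<close>, \<open>r\<close> and
  \<open>K\<close>, so only the leading term 2z of the second contributes.\<close>

lemma residual_residual:
  assumes y: "y \<in> Y" and z: "z \<in> Y"
  shows "lform R (c y) (c z) = 4 * gram R y z - 1 - sgn_adj p y * sgn_adj p z
    - (\<Sum>x\<leftarrow>K. sgn_adj x y * sgn_adj x z)"
proof -
  have "lform R (c y) (map (\<lambda>x. (g x, x)) K') = 0" if "set K' \<subseteq> set K" for g K'
    using that by (induction K') (auto simp: lform_Cons_right residual_K[OF y])
  then have "lform R (c y) (c z) = 2 * lval R (c y) z"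
    unfolding residual_def[of p r K z] Let_def
    by (simp add: lform_Cons_right residual_p[OF y] residual_r[OF y])
  moreover have "(\<Sum>x\<leftarrow>K. sgn_adj x y * gram R x z)
      = (\<Sum>x\<leftarrow>K. sgn_adj x y) / 2 + (\<Sum>x\<leftarrow>K. sgn_adj x y * sgn_adj x z) / 2"
  proof -
    have "(\<Sum>x\<leftarrow>K. sgn_adj x y * gram R x z) = (\<Sum>x\<leftarrow>K. sgn_adj x y / 2 + sgn_adj x y * sgn_adj x z / 2)"
      by (intro arg_cong[of _ _ sum_list] map_cong refl) (use YD[OF z] in \<open>auto simp: gram_def sgn_adj_def\<close>)
    also have "(\<Sum>x\<leftarrow>K'. f x / 2 + g x / 2) = (\<Sum>x\<leftarrow>K'. f x) / 2 + (\<Sum>x\<leftarrow>K'. g x) / 2"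
      for f g :: "'a \<Rightarrow> real" and K'
      by (induction K') (auto simp: field_simps)
    finally show ?thesis .
  qed
  moreover have "gram R p z = (1 + sgn_adj p z) / 2" "gram R r z = (1 - sgn_adj p z) / 2"
    using YD[OF z] by (auto simp: gram_def sgn_adj_def)
  ultimately show ?thesis unfolding lval_residual by (simp add: field_simps)
qed

lemma residual_support: "y \<in> V \<Longrightarrow> snd ` set (c y) \<subseteq> V"
  using pr K unfolding residual_def Let_def by auto

lemma coef_residual:
  assumes "y \<in> Y" "v \<in> Y" shows "coef (c y) v = (if v = y then 2 else 0)"
proof -
  have "coef (map (\<lambda>x. (g x, x)) K') v = 0" if "v \<notin> set K'" for g K'
    using that by (induction K') auto
  then show ?thesis using YD[OF assms(2)] unfolding residual_def Let_def by auto
qed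

text \<open>Strict Cauchy-Schwarz for residuals of equal norm 4 * 2 - 2 - \<open>length K\<close>.
  They are independent because a private vertex occurs only in its own residual.\<close>

lemma residual_abs_less:
  assumes "y \<in> Y" "z \<in> Y" "y \<noteq> z"
  shows "\<bar>lform R (c y) (c z)\<bar> < 6 - real (length K)"
proof -
  have norm: "lform R (c u) (c u) = 6 - real (length K)" if "u \<in> Y" for u
  proof -
    have "sgn_adj x u * sgn_adj x u = 1" for x by (simp add: sgn_adj_def)
    then show ?thesis using residual_residual[OF that that] by (simp add: gram_def sum_list_triv)
  qed
  have "0 < lform R (c y @ smul s (c z)) (c y @ smul s (c z))" for s
    by (rule pd[of _ y]) (use assms residual_support YD(1) in \<open>auto simp: image_Un coef_residual\<close>)
  from this[of 1] this[of "- 1"] show ?thesis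
    using norm assms lform_sym[of "c z" "c y"] by (simp add: abs_less_iff)
qed

lemma four_elements:
  assumes "4 \<le> card A"
  obtains w x y z where "{w, x, y, z} \<subseteq> A" "distinct [w, x, y, z]"
proof -
  obtain T where "T \<subseteq> A" "card T = 4" "finite T"
    using obtain_subset_with_card_n[OF assms] by blast
  moreover obtain zs where "set zs = T" "distinct zs"
    using finite_distinct_list[OF \<open>finite T\<close>] by blast
  ultimately have "length zs = 4" "set zs \<subseteq> A" "distinct zs" using distinct_card by force+
  then show ?thesis using that by (auto simp: eval_nat_numeral length_Suc_conv)
qed

lemma residual_combination_pos:
  assumes "set ys \<subseteq> Y" "y \<in> set ys" "distinct ys" "\<forall>z\<in>set ys. s z \<noteq> 0"
  defines "w \<equiv> concat (map (\<lambda>z. smul (s z) (c z)) ys)"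
  shows "0 < lform R w w"
proof (rule pd[of _ y])
  show "snd ` set w \<subseteq> V"
    using assms(1) residual_support YD(1) unfolding w_def by (simp add: image_UN) blast
  show "y \<in> V" using assms YD(1) by blast
  have "y \<in> Y" using assms by blast
  have "coef (concat (map (\<lambda>z. smul (s z) (c z)) zs)) y = (if y \<in> set zs then 2 * s y else 0)"
    if "set zs \<subseteq> Y" "distinct zs" for zs
    using that by (induction zs) (auto simp: coef_residual[OF _ \<open>y \<in> Y\<close>])
  then show "coef w y \<noteq> 0" using assms unfolding w_def by simp
qed

text \<open>After a change of signs the residuals with respect to three common neighbours have norm 3 and
  pairwise inner product -1, so that any four of them add up to a null vector.\<close>

lemma card_private_nbrs_le:
  assumes "length K = 3"
  shows "card Y \<le> 3"
proof (rule ccontr)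
  assume "\<not> card Y \<le> 3"
  then have "4 \<le> card Y" by simp
  from four_elements[OF this] obtain y1 y2 y3 y4
    where sub: "{y1, y2, y3, y4} \<subseteq> Y" and dist: "distinct [y1, y2, y3, y4]" .
  from sub have y: "y1 \<in> Y" "y2 \<in> Y" "y3 \<in> Y" "y4 \<in> Y" by auto
  obtain a b d where Kabd: "K = [a, b, d]"
    using assms by (auto simp: numeral_3_eq_3 length_Suc_conv)
  define s where "s y = sgn_adj p y * (sgn_adj a y * sgn_adj b y * sgn_adj d y)" for y
  have s: "s y \<noteq> 0" "s y * s y = 1" for y by (auto simp: s_def sgn_adj_def)
  \<comment> \<open>Modulo 4, a sum of five signs is determined by their product. The inner product
    is a multiple of 4 minus such a sum (one sign being 1) and is below 3 in absolute value, so it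
    is minus the product.\<close>
  have pair: "s u * s v * lform R (c u) (c v) = - 1" if "u \<in> Y" "v \<in> Y" "u \<noteq> v" for u v
  proof -
    define t where "t x = sgn_adj x u * sgn_adj x v" for x
    have "t x = 1 \<or> t x = - 1" for x unfolding t_def by (rule sgn_adj_prod)
    then have t: "t p = 1 \<or> t p = - 1" "t a = 1 \<or> t a = - 1" "t b = 1 \<or> t b = - 1" "t d = 1 \<or> t d = - 1"
      by blast+
    have "gram R u v = 0 \<or> gram R u v = 1" using that by (auto simp: gram_def)
    moreover have val: "lform R (c u) (c v) = 4 * gram R u v - 1 - t p - (t a + t b + t d)"
      using residual_residual[OF that(1,2)] by (simp add: Kabd t_def)
    moreover have "\<bar>4 * gram R u v - 1 - t p - (t a + t b + t d)\<bar> < 3"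
      using residual_abs_less[OF that] assms unfolding val by simp
    moreover have "s u * s v = t p * (t a * t b * t d)" by (simp add: s_def t_def mult_ac)
    ultimately show ?thesis using t by (elim disjE) simp_all
  qed
  have self: "s u * s u * lform R (c u) (c u) = 3" if "u \<in> Y" for u
  proof -
    have "sgn_adj x u * sgn_adj x u = 1" for x by (simp add: sgn_adj_def)
    then show ?thesis using residual_residual[OF that that] s(2)[of u] by (simp add: gram_def Kabd)
  qed
  let ?w = "concat (map (\<lambda>z. smul (s z) (c z)) [y1, y2, y3, y4])"
  have "lform R ?w ?w = (\<Sum>u\<leftarrow>[y1, y2, y3, y4]. \<Sum>v\<leftarrow>[y1, y2, y3, y4]. s u * s v * lform R (c u) (c v))"
    by (simp add: algebra_simps)
  also have "\<dots> = 0"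
  proof -
    have "distinct [y4, y3, y2, y1]" using dist by auto
    then show ?thesis using y dist by (simp add: self pair)
  qed
  finally show False
    using residual_combination_pos[of "[y1, y2, y3, y4]" y1 s] y dist s(1) by simp
qed

text \<open>For two common neighbours the residuals have norm 4; they are orthogonal when their signs
  \<open>\<pi>\<close> agree and have inner product 2 or -2 otherwise, so that four residuals of one sign
  span every residual of the other sign.\<close>

lemma private_nbrs_parity:
  assumes Kab: "K = [a, b]" and card: "8 \<le> card Y"
  defines "\<pi> \<equiv> \<lambda>y. sgn_adj p y * (sgn_adj a y * sgn_adj b y)"
  shows "\<lbrakk>u \<in> Y; v \<in> Y\<rbrakk> \<Longrightarrow> \<pi> u = \<pi> v"
    and "\<lbrakk>u \<in> Y; v \<in> Y; R u v\<rbrakk> \<Longrightarrow> sgn_adj a u = sgn_adj a v"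
proof -
  have \<pi>: "\<pi> y = 1 \<or> \<pi> y = - 1" for y by (auto simp: \<pi>_def sgn_adj_def)
  \<comment> \<open>Here there are four signs, one of them 1: their sum is 0 modulo 4 iff their
    product is 1, and the bound is 4. Inner product 0 for adjacent vertices forces all signs to be
    1, whence agreement at \<open>a\<close>.\<close>
  have pair: "(\<pi> u = \<pi> v \<longrightarrow> lform R (c u) (c v) = 0 \<and> (R u v \<longrightarrow> sgn_adj a u = sgn_adj a v)) \<and>
      (\<pi> u \<noteq> \<pi> v \<longrightarrow> \<bar>lform R (c u) (c v)\<bar> = 2)" if "u \<in> Y" "v \<in> Y" "u \<noteq> v" for u v
  proof -
    define t where "t x = sgn_adj x u * sgn_adj x v" for x
    have "t x = 1 \<or> t x = - 1" for x unfolding t_def by (rule sgn_adj_prod)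
    then have t: "t p = 1 \<or> t p = - 1" "t a = 1 \<or> t a = - 1" "t b = 1 \<or> t b = - 1"
      by blast+
    have g: "gram R u v = 0 \<and> \<not> R u v \<or> gram R u v = 1" using that by (auto simp: gram_def)
    have val: "lform R (c u) (c v) = 4 * gram R u v - 1 - t p - (t a + t b)"
      using residual_residual[OF that(1,2)] by (simp add: Kab t_def)
    have bound: "\<bar>4 * gram R u v - 1 - t p - (t a + t b)\<bar> < 4"
      using residual_abs_less[OF that] unfolding val by (simp add: Kab)
    have eq: "\<pi> u = \<pi> v \<longleftrightarrow> t p * (t a * t b) = 1"
    proof -
      have "\<pi> u * \<pi> v = t p * (t a * t b)" by (simp add: \<pi>_def t_def mult_ac)
      then show ?thesis using \<pi>[of u] \<pi>[of v] by auto
    qed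
    have ta: "t a = 1 \<longleftrightarrow> sgn_adj a u = sgn_adj a v" by (auto simp: t_def sgn_adj_def)
    show ?thesis unfolding val eq ta[symmetric]
      using g t bound by (elim disjE) simp_all
  qed
  have self: "lform R (c u) (c u) = 4" if "u \<in> Y" for u
  proof -
    have "sgn_adj x u * sgn_adj x u = 1" for x by (simp add: sgn_adj_def)
    then show ?thesis using residual_residual[OF that that] by (simp add: gram_def Kab)
  qed
  have few: "card {y \<in> Y. \<pi> y = e} < 4" if z: "z \<in> Y" "\<pi> z \<noteq> e" for z e
  proof (rule ccontr)
    assume "\<not> card {y \<in> Y. \<pi> y = e} < 4"
    then have "4 \<le> card {y \<in> Y. \<pi> y = e}" by simp
    from four_elements[OF this] obtain y1 y2 y3 y4
      where sub: "{y1, y2, y3, y4} \<subseteq> {y \<in> Y. \<pi> y = e}" and dist: "distinct [y1, y2, y3, y4]" .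
    from sub have y: "y1 \<in> Y" "y2 \<in> Y" "y3 \<in> Y" "y4 \<in> Y"
      "\<pi> y1 = e" "\<pi> y2 = e" "\<pi> y3 = e" "\<pi> y4 = e" by auto
    \<comment> \<open>Projecting the residual of \<open>z\<close> onto four orthogonal vectors of
      norm 4, with inner products 2 or -2, already gives its full norm 4. So its double is their
      signed sum, which fixes these coefficients.\<close>
    define s where "s u = (if u = z then 2 else - lform R (c z) (c u) / 2)" for u
    have zy: "z \<notin> {y1, y2, y3, y4}" using y z by auto
    have u: "u \<in> Y" "\<pi> u = e" "z \<noteq> u" if "u \<in> {y1, y2, y3, y4}" for u
      using that sub z by blast+
    have abs2: "\<bar>lform R (c z) (c u)\<bar> = 2" if "u \<in> {y1, y2, y3, y4}" for u
      using pair[OF z(1) u(1)[OF that] u(3)[OF that]] u(2)[OF that] z(2) by simp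
    have sz: "lform R (c z) (c u) = - 2 * s u" "lform R (c u) (c z) = - 2 * s u" "s u * s u = 1"
      if "u \<in> {y1, y2, y3, y4}" for u
    proof -
      have "lform R (c z) (c u) = 2 \<or> lform R (c z) (c u) = - 2" using abs2[OF that] by linarith
      then show "lform R (c z) (c u) = - 2 * s u" "lform R (c u) (c z) = - 2 * s u" "s u * s u = 1"
        using u(3)[OF that] lform_sym[of "c u" "c z"] by (auto simp: s_def)
    qed
    have nz: "\<forall>u\<in>set [z, y1, y2, y3, y4]. s u \<noteq> 0"
    proof
      fix v assume "v \<in> set [z, y1, y2, y3, y4]"
      then consider "v = z" | "v \<in> {y1, y2, y3, y4}" by auto
      then show "s v \<noteq> 0" using sz(3)[of v] by cases (auto simp: s_def[of z])
    qed
    have orth: "lform R (c u) (c v) = 0" if "u \<in> {y1, y2, y3, y4}" "v \<in> {y1, y2, y3, y4}" "u \<noteq> v" for u v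
      using pair[OF u(1)[OF that(1)] u(1)[OF that(2)] that(3)] u(2)[OF that(1)] u(2)[OF that(2)] by simp
    let ?w = "concat (map (\<lambda>z. smul (s z) (c z)) [z, y1, y2, y3, y4])"
    have "lform R ?w ?w = (\<Sum>u\<leftarrow>[z, y1, y2, y3, y4]. \<Sum>v\<leftarrow>[z, y1, y2, y3, y4]. s u * s v * lform R (c u) (c v))"
      by (simp add: algebra_simps)
    also have "\<dots> = 16 - 4 * (s y1 * s y1 + s y2 * s y2 + s y3 * s y3 + s y4 * s y4)
         - 4 * (s y1 * s y1 + s y2 * s y2 + s y3 * s y3 + s y4 * s y4)
         + 4 * (s y1 * s y1 + s y2 * s y2 + s y3 * s y3 + s y4 * s y4)"
    proof -
      have "distinct [y4, y3, y2, y1]" using dist by auto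
      then show ?thesis using dist by (simp add: self[OF z(1)] self[OF y(1)] self[OF y(2)] self[OF y(3)] self[OF y(4)] orth sz(1,2)) (simp add: s_def[of z] algebra_simps)
    qed
    also have "\<dots> = 0" by (simp add: sz(3))
    finally show False
      using residual_combination_pos[of "[z, y1, y2, y3, y4]" z s] y dist z(1) zy nz by auto
  qed
  \<comment> \<open>If both signs occurred, each would occur at most three times, and 3 + 3 <
    8.\<close>
  have same: "\<pi> u = \<pi> v" if uv: "u \<in> Y" "v \<in> Y" for u v
  proof (rule ccontr)
    assume "\<pi> u \<noteq> \<pi> v"
    then have "Y = {y \<in> Y. \<pi> y = \<pi> u} \<union> {y \<in> Y. \<pi> y = \<pi> v}"
      using \<pi>[of u] \<pi>[of v] \<pi> by fastforce
    then have "card Y \<le> card {y \<in> Y. \<pi> y = \<pi> u} + card {y \<in> Y. \<pi> y = \<pi> v}"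
      using card_Un_le by metis
    then show False using few[OF uv(1), of "\<pi> v"] few[OF uv(2), of "\<pi> u"] \<open>\<pi> u \<noteq> \<pi> v\<close> card by auto
  qed
  show "\<lbrakk>u \<in> Y; v \<in> Y\<rbrakk> \<Longrightarrow> \<pi> u = \<pi> v" by (rule same)
  show "\<lbrakk>u \<in> Y; v \<in> Y; R u v\<rbrakk> \<Longrightarrow> sgn_adj a u = sgn_adj a v"
    using pair same irrefl by (cases "u = v") blast+
qed

end

section \<open>The distance-two graph of a regular bipartite graph\<close>

text \<open>The spectral hypothesis enters only through \<open>norm\<close>, which says |Ax|^2 > (k
  - 2)|x|^2. Both sides are treated at once: \<open>F l p\<close> may be read as "\<open>p\<close>
  lies on the line \<open>l\<close>" with the roles either way.\<close>

locale pd_regular_graph =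
  fixes V :: "'a set" and F :: "'a \<Rightarrow> 'a \<Rightarrow> bool" and k :: nat and S :: "'a set"
  assumes fin: "finite V"
    and F_V: "F u v \<Longrightarrow> u \<in> V"
    and F_sym: "F u v \<Longrightarrow> F v u"
    and deg: "v \<in> V \<Longrightarrow> card {u. F v u} = k"
    and k3: "3 \<le> k"
    and bip: "F u v \<Longrightarrow> u \<in> S \<longleftrightarrow> v \<notin> S"
    and norm: "\<And>x :: 'a \<Rightarrow> real. \<exists>v\<in>V. x v \<noteq> 0 \<Longrightarrow>
      (real k - 2) * (\<Sum>v\<in>V. (x v)\<^sup>2) < (\<Sum>u\<in>V. (\<Sum>v | F u v. x v)\<^sup>2)"
begin

abbreviation N :: "'a \<Rightarrow> 'a set" where "N v \<equiv> {u. F v u}"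

definition adj :: "'a \<Rightarrow> 'a \<Rightarrow> bool" where
  "adj u v \<longleftrightarrow> u \<noteq> v \<and> (\<exists>w. F w u \<and> F w v)"

lemma F_V2: "F u v \<Longrightarrow> v \<in> V" using F_V F_sym by blast

lemma finite_N [simp]: "finite (N v)"
  by (rule finite_subset[OF _ fin]) (use F_V2 in blast)

lemma adj_sym: "adj u v \<Longrightarrow> adj v u" by (auto simp: adj_def)

lemma adj_V: "adj u v \<Longrightarrow> u \<in> V" "adj u v \<Longrightarrow> v \<in> V" using F_V2 by (auto simp: adj_def)

lemma codegree_form_pos:
  fixes x :: "'a \<Rightarrow> real"
  assumes "\<exists>v\<in>V. x v \<noteq> 0"
  shows "0 < (\<Sum>v\<in>V. \<Sum>w\<in>V. x v * x w * (real (card (N v \<inter> N w)) - (if v = w then real k - 2 else 0)))"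
proof -
  have "(\<Sum>u\<in>V. (\<Sum>v | F u v. x v)\<^sup>2) = (\<Sum>u\<in>V. \<Sum>v\<in>V. \<Sum>w\<in>V. x v * x w * of_bool (F u v \<and> F u w))"
  proof (intro sum.cong refl)
    fix u
    have "(\<Sum>v | F u v. x v) = (\<Sum>v\<in>V. x v * of_bool (F u v))"
      using F_V2 fin by (intro sum.mono_neutral_cong_left) auto
    then have "(\<Sum>v | F u v. x v)\<^sup>2 = (\<Sum>v\<in>V. \<Sum>w\<in>V. (x v * of_bool (F u v)) * (x w * of_bool (F u w)))"
      by (simp only: power2_eq_square sum_product)
    then show "(\<Sum>v | F u v. x v)\<^sup>2 = (\<Sum>v\<in>V. \<Sum>w\<in>V. x v * x w * of_bool (F u v \<and> F u w))"
      by (simp add: of_bool_conj mult_ac)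
  qed
  also have "\<dots> = (\<Sum>v\<in>V. \<Sum>u\<in>V. \<Sum>w\<in>V. x v * x w * of_bool (F u v \<and> F u w))"
    by (rule sum.swap)
  also have "\<dots> = (\<Sum>v\<in>V. \<Sum>w\<in>V. \<Sum>u\<in>V. x v * x w * of_bool (F u v \<and> F u w))"
    by (intro sum.cong refl sum.swap)
  also have "\<dots> = (\<Sum>v\<in>V. \<Sum>w\<in>V. x v * x w * real (card (N v \<inter> N w)))"
  proof (intro sum.cong refl)
    fix v w
    have "{u \<in> V. F u v \<and> F u w} = N v \<inter> N w" using F_sym F_V by blast
    then show "(\<Sum>u\<in>V. x v * x w * of_bool (F u v \<and> F u w)) = x v * x w * real (card (N v \<inter> N w))"
      using fin by (simp add: sum_distrib_left[symmetric] of_bool_def sum.If_cases Int_def)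
  qed
  finally have "(\<Sum>u\<in>V. (\<Sum>v | F u v. x v)\<^sup>2) = \<dots>" .
  moreover have "(real k - 2) * (\<Sum>v\<in>V. (x v)\<^sup>2) = (\<Sum>v\<in>V. \<Sum>w\<in>V. x v * x w * (if v = w then real k - 2 else 0))"
    using fin by (simp add: sum_distrib_left if_distrib power2_eq_square mult_ac cong: if_cong)
  ultimately show ?thesis
    using norm[OF assms] by (simp add: right_diff_distrib sum_subtractf)
qed

text \<open>On e_u - e_v the form takes the value 2 + 2 - 2c, where c is the number of common
  neighbours.\<close>

lemma codegree_le_1:
  assumes "F w u" "F w v" "F w' u" "F w' v" "u \<noteq> v"
  shows "w = w'"
proof (rule ccontr)
  assume "w \<noteq> w'"
  define G where "G a b = real (card (N a \<inter> N b)) - (if a = b then real k - 2 else 0)" for a b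
  define x where "x t = (if t = u then 1 else 0) - (if t = v then 1 else (0::real))" for t
  have V: "u \<in> V" "v \<in> V" using assms F_V2 by auto
  have "(\<Sum>b\<in>V. x a * x b * G a b) = x a * G a u - x a * G a v" for a
  proof -
    have "(\<Sum>b\<in>V. x a * x b * G a b) = (\<Sum>b\<in>V. (if b = u then x a * G a u else 0) - (if b = v then x a * G a v else 0))"
      by (intro sum.cong) (auto simp: x_def)
    then show ?thesis using V fin by (simp add: sum_subtractf)
  qed
  then have "(\<Sum>a\<in>V. \<Sum>b\<in>V. x a * x b * G a b)
      = (\<Sum>a\<in>V. (if a = u then G u u - G u v else 0) - (if a = v then G v u - G v v else 0))"
    by (intro sum.cong) (auto simp: x_def)
  also have "\<dots> = G u u - G u v - G v u + G v v"
    using V fin by (simp add: sum_subtractf)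
  moreover have "0 < (\<Sum>a\<in>V. \<Sum>b\<in>V. x a * x b * G a b)"
    unfolding G_def by (rule codegree_form_pos) (use V assms(5) in \<open>auto simp: x_def intro!: bexI[of _ u]\<close>)
  ultimately have "0 < G u u - G u v - G v u + G v v" by simp
  moreover have "G u u = 2" "G v v = 2" using deg V by (auto simp: G_def)
  moreover have "card {w, w'} \<le> card (N u \<inter> N v)"
    using assms F_sym by (intro card_mono) auto
  then have "G u v \<ge> 2" using \<open>w \<noteq> w'\<close> assms(5) by (simp add: G_def)
  moreover have "G v u = G u v" by (simp add: G_def Int_commute)
  ultimately show False by linarith
qed

lemma codegree_gram:
  assumes "v \<in> V"
  shows "real (card (N v \<inter> N w)) - (if v = w then real k - 2 else 0) = gram adj v w"
proof (cases "v = w \<or> N v \<inter> N w = {}")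
  case True
  then have "\<not> adj v w" using F_sym unfolding adj_def by blast
  then show ?thesis using True assms deg by (auto simp: gram_def)
next
  case False
  then obtain u where u: "u \<in> N v \<inter> N w" by blast
  then have "N v \<inter> N w = {u}" using False codegree_le_1 F_sym by blast
  then show ?thesis using False u F_sym by (auto simp: gram_def adj_def)
qed

lemma sum_list_coef:
  assumes "snd ` set xs \<subseteq> V"
  shows "(\<Sum>x\<leftarrow>xs. fst x * g (snd x)) = (\<Sum>v\<in>V. coef xs v * g v)"
  using assms
proof (induction xs)
  case (Cons x xs)
  obtain c p where "x = (c, p)" by (cases x)
  then have "(\<Sum>v\<in>V. coef (x # xs) v * g v) = (\<Sum>v\<in>V. (if v = snd x then fst x * g (snd x) else 0) + coef xs v * g v)"
    by (intro sum.cong) (auto simp: distrib_right)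
  then show ?case using Cons fin by (simp add: sum.distrib)
qed simp

sublocale adj: posdef_graph V adj
proof
  show "adj u v \<Longrightarrow> adj v u" for u v by (rule adj_sym)
  show "\<not> adj u u" for u by (simp add: adj_def)
  fix xs v assume xs: "snd ` set xs \<subseteq> V" "v \<in> V" "coef xs v \<noteq> 0"
  have "lform adj xs xs = (\<Sum>x\<leftarrow>xs. fst x * (\<Sum>w\<in>V. coef xs w * gram adj (snd x) w))"
    unfolding lform_def
    by (intro arg_cong[of _ _ sum_list] map_cong refl)
      (simp add: sum_list_coef[OF xs(1), symmetric] sum_list_const_mult[symmetric] mult_ac)
  also have "\<dots> = (\<Sum>v\<in>V. coef xs v * (\<Sum>w\<in>V. coef xs w * gram adj v w))"
    by (rule sum_list_coef[OF xs(1)])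
  also have "\<dots> = (\<Sum>v\<in>V. \<Sum>w\<in>V. coef xs v * coef xs w * (real (card (N v \<inter> N w)) - (if v = w then real k - 2 else 0)))"
    by (simp add: sum_distrib_left codegree_gram mult.assoc)
  finally show "0 < lform adj xs xs" using codegree_form_pos[of "coef xs"] xs by auto
qed


lemma adjI: "F w u \<Longrightarrow> F w v \<Longrightarrow> u \<noteq> v \<Longrightarrow> adj u v"
  by (auto simp: adj_def)

lemma exists_neighbour:
  assumes "v \<in> V" shows "\<exists>w. F v w \<and> w \<noteq> x \<and> w \<noteq> y"
proof (rule ccontr)
  assume "\<not> (\<exists>w. F v w \<and> w \<noteq> x \<and> w \<noteq> y)"
  then have "card (N v) \<le> card {x, y}" by (intro card_mono) auto
  also have "\<dots> \<le> 2" by (simp add: card_insert_if)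
  finally show False using deg[OF assms] k3 by simp
qed

lemma finite_adj [simp]: "finite {u. adj v u}"
  by (rule finite_subset[OF _ fin]) (use adj_V in blast)

lemma card_adj:
  assumes "v \<in> V" shows "card {u. adj v u} = k * (k - 1)"
proof -
  have "{u. adj v u} = (\<Union>w\<in>N v. N w - {v})"
    using F_sym unfolding adj_def by blast
  also have "card \<dots> = (\<Sum>w\<in>N v. card (N w - {v}))"
  proof (rule card_UN_disjoint)
    show "\<forall>i\<in>N v. \<forall>j\<in>N v. i \<noteq> j \<longrightarrow> (N i - {v}) \<inter> (N j - {v}) = {}"
      using F_sym codegree_le_1 by blast
  qed auto
  also have "\<dots> = (\<Sum>w\<in>N v. k - 1)"
  proof (intro sum.cong refl)
    fix w assume "w \<in> N v"
    then have "v \<in> N w" "card (N w) = k" using F_sym F_V2 deg by auto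
    then show "card (N w - {v}) = k - 1" by simp
  qed
  finally show ?thesis using deg[OF assms] by simp
qed

text \<open>The \<open>k\<close> neighbours of \<open>l\<close> are joined to \<open>a\<close> through distinct neighbours of \<open>a\<close>, of which
  there are only \<open>k\<close>.\<close>

lemma meets_all:
  assumes "l \<in> V" "\<not> F l a" "\<And>z. F l z \<Longrightarrow> adj a z" "F m a"
  shows "\<exists>z. F l z \<and> F m z"
proof -
  define g where "g z = (SOME w. F w a \<and> F w z)" for z
  have g: "F (g z) a \<and> F (g z) z" if "F l z" for z
  proof -
    have "\<exists>w. F w a \<and> F w z" using assms(3)[OF that] unfolding adj_def by blast
    then show ?thesis unfolding g_def by (rule someI_ex)
  qed
  have a: "a \<in> V" using F_V2[OF assms(4)] .
  have "inj_on g (N l)"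
  proof (rule inj_onI, rule ccontr)
    fix z z' assume z: "z \<in> N l" "z' \<in> N l" "g z = g z'" "z \<noteq> z'"
    then have "g z = l" using codegree_le_1[of "g z" z z' l] g by (metis mem_Collect_eq)
    then show False using g z(1) assms(2) by auto
  qed
  then have "card (g ` N l) = card (N a)"
    using deg[OF assms(1)] deg[OF a] by (simp add: card_image)
  moreover have "g ` N l \<subseteq> N a" using g F_sym by blast
  ultimately have "g ` N l = N a" by (simp add: card_subset_eq)
  then have "m \<in> g ` N l" using F_sym[OF assms(4)] by simp
  then show ?thesis using g by blast
qed

section \<open>Nonadjacent vertices have at most one common neighbour\<close>

definition common :: "'a \<Rightarrow> 'a \<Rightarrow> 'a set" where
  "common p r = {x. adj p x \<and> adj r x}"

lemma common_adjacent:
  assumes "p \<noteq> r" "\<not> adj p r" "a \<in> common p r" "b \<in> common p r" "a \<noteq> b"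
  shows "adj a b"
  by (rule adj.common_neighbours_adjacent[of p r]) (use assms adj_V in \<open>auto simp: common_def\<close>)

lemma finite_common [simp]: "finite (common p r)"
  by (rule finite_subset[of _ "{x. adj p x}"]) (auto simp: common_def)

lemma card_private:
  assumes "p \<in> V" "r \<in> V" "\<not> adj p r"
  shows "card (adj.private_nbrs p r) = 2 * (k * (k - 1) - card (common p r))"
    and "card ({y. adj p y} - common p r) = k * (k - 1) - card (common p r)"
proof -
  have c: "card ({y. adj q y} - common p r) = k * (k - 1) - card (common p r)" if "q \<in> {p, r}" for q
    using that assms by (subst card_Diff_subset) (auto simp: card_adj common_def)
  have "adj.private_nbrs p r = ({y. adj p y} - common p r) \<union> ({y. adj r y} - common p r)"
    unfolding adj.private_nbrs_def common_def using adj_V by auto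
  moreover have "({y. adj p y} - common p r) \<inter> ({y. adj r y} - common p r) = {}"
    by (auto simp: common_def)
  ultimately show "card (adj.private_nbrs p r) = 2 * (k * (k - 1) - card (common p r))"
    using c by (simp add: card_Un_disjoint)
  show "card ({y. adj p y} - common p r) = k * (k - 1) - card (common p r)" using c by simp
qed

text \<open>Otherwise \<open>p\<close> has at most one neighbour that is not common. A common
  neighbour is adjacent to \<open>p\<close>, \<open>r\<close> and all other common ones; this
  exhausts its degree and leaves exactly one private neighbour \<open>y\<close> of \<open>p\<close>,
  adjacent to no common one.\<close>

lemma card_common_le_2:
  assumes "p \<in> V" "r \<in> V" "p \<noteq> r" "\<not> adj p r"
  shows "card (common p r) \<le> 2"
proof (rule ccontr)
  assume "\<not> card (common p r) \<le> 2"
  then have "3 \<le> card (common p r)" by simp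
  then obtain T where T: "T \<subseteq> common p r" "card T = 3" "finite T"
    using obtain_subset_with_card_n by blast
  then obtain K where K: "set K = T" "distinct K" using finite_distinct_list by blast
  then have len: "length K = 3" using T distinct_card by force
  interpret pair: nonadjacent_pair V adj p r K
  proof unfold_locales
    have "x \<in> common p r" if "x \<in> set K" for x using that K T by blast
    then show "\<And>x. x \<in> set K \<Longrightarrow> adj p x" "\<And>x. x \<in> set K \<Longrightarrow> adj r x" "set K \<subseteq> V"
        "\<And>x y. \<lbrakk>x \<in> set K; y \<in> set K; x \<noteq> y\<rbrakk> \<Longrightarrow> adj x y"
      using common_adjacent[OF assms(3,4)] adj_V(2) unfolding common_def by blast+
  qed (fact assms K)+
  have le3: "2 * (k * (k - 1) - card (common p r)) \<le> 3"
    using pair.card_private_nbrs_le[OF len] card_private(1)[OF assms(1,2,4)] by simp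
  have nbrs: "{y. adj x y} = insert p (insert r (common p r - {x})) \<and> card (common p r) + 1 = k * (k - 1)"
    if x: "x \<in> common p r" for x
  proof -
    have pr: "p \<notin> common p r" "r \<notin> common p r" "x \<noteq> p" "x \<noteq> r"
      using x by (auto simp: common_def adj_def)
    have sub: "insert p (insert r (common p r - {x})) \<subseteq> {y. adj x y}"
      using common_adjacent[OF assms(3,4) x] x adj_sym by (auto simp: common_def)
    have cc: "card (insert p (insert r (common p r - {x}))) = card (common p r) + 1"
      using pr assms(3) x by (simp add: card_Diff_singleton card_gt_0_iff) (metis Suc_pred card_gt_0_iff empty_iff finite_common)
    have "x \<in> V" using x adj_V by (auto simp: common_def)
    then have cx: "card {y. adj x y} = k * (k - 1)" by (rule card_adj)
    then have "card (common p r) + 1 \<le> k * (k - 1)" using card_mono[OF finite_adj sub] cc by simp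
    then have eq: "card (common p r) + 1 = k * (k - 1)" using le3 by simp
    then show ?thesis using card_subset_eq[OF finite_adj sub] cc cx by simp
  qed
  obtain x0 where "x0 \<in> common p r" using T(1,2) by (cases "T = {}") auto
  then have "card ({y. adj p y} - common p r) = 1"
    using nbrs[of x0] card_private(2)[OF assms(1,2,4)] by linarith
  then obtain y where y: "{y. adj p y} - common p r = {y}" by (rule card_1_singletonE)
  then have "adj p y" by blast
  then obtain w where w: "F w p" "F w y" by (auto simp: adj_def)
  \<comment> \<open>A third point on the line through \<open>p\<close> and \<open>y\<close>: it is a
    common neighbour, yet adjacent to \<open>y\<close>.\<close>
  obtain x where x: "F w x" "x \<notin> {p, y}"
    using exists_neighbour[of w p y] F_V[OF w(1)] by auto
  then have "x \<in> {y. adj p y}" "x \<noteq> y" using w adjI by auto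
  then have "x \<in> common p r" using y by blast
  moreover have "adj x y" using x w adjI by blast
  ultimately have "y = p \<or> y = r \<or> y \<in> common p r" using nbrs by blast
  then show False using y \<open>adj p y\<close> assms(4) by (auto simp: adj_def)
qed

text \<open>A line \<open>l\<close> through \<open>p\<close> avoiding \<open>a\<close> and \<open>b\<close> lies entirely in the neighbourhood of one of them,
  say \<open>c\<close>. Then every line through \<open>c\<close> meets \<open>l\<close>; the one through \<open>r\<close> gives a third
  common neighbour of \<open>p\<close> and \<open>r\<close>.\<close>

lemma odd_side_impossible:
  assumes "p \<in> V" "p \<noteq> r" "\<not> adj p r" and com: "common p r = {a, b}"
    and one: "\<And>y. adj p y \<Longrightarrow> \<not> adj r y \<Longrightarrow> adj a y \<longleftrightarrow> \<not> adj b y"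
    and same: "\<And>y z. \<lbrakk>adj p y; \<not> adj r y; adj p z; \<not> adj r z; adj y z\<rbrakk> \<Longrightarrow> adj a y \<longleftrightarrow> adj a z"
  shows False
proof -
  have ab: "adj p a" "adj r a" "adj p b" "adj r b" using com by (auto simp: common_def)
  obtain wa wb where w: "F wa p" "F wa a" "F wb p" "F wb b" using ab by (auto simp: adj_def)
  obtain l where l: "F p l" "l \<notin> {wa, wb}"
    using exists_neighbour[OF assms(1), of wa wb] by auto
  have lp: "F l p" using l F_sym by blast
  have nla: "\<not> F l a" "\<not> F l b"
    using codegree_le_1[OF lp _ w(1,2)] codegree_le_1[OF lp _ w(3,4)] l ab by (auto simp: adj_def)
  have priv: "adj p z \<and> \<not> adj r z" if "F l z" "z \<noteq> p" for z
    using adjI[OF lp that(1)] that nla com by (auto simp: common_def)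
  obtain z0 where z0: "F l z0" "z0 \<noteq> p"
    using exists_neighbour[of l p p] F_V[OF lp] by auto
  have "\<exists>c\<in>{a, b}. \<forall>z. F l z \<longrightarrow> adj c z"
  proof -
    have "(adj a z \<longleftrightarrow> adj a z0) \<and> (adj b z \<longleftrightarrow> adj b z0)" if "F l z" "z \<noteq> p" for z
      using same[of z z0] one[of z] one[of z0] priv[OF that] priv[OF z0] adjI[OF that(1) z0(1)] by blast
    moreover have "adj a z0 \<or> adj b z0" using one priv[OF z0] by blast
    moreover have "adj a p" "adj b p" using ab adj_sym by auto
    ultimately show ?thesis by blast
  qed
  then obtain c where c: "c \<in> {a, b}" "\<And>z. F l z \<Longrightarrow> adj c z" by blast
  have "adj r c" using c ab by auto
  then obtain m where m: "F m r" "F m c" by (auto simp: adj_def)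
  obtain x where x: "F l x" "F m x"
    using meets_all[of l c m] F_V[OF lp] c nla m by blast
  have "x \<noteq> p" using adjI[of m p r] x m assms(2,3) by blast
  moreover have "x \<noteq> r" using adjI[of l p r] x lp assms(2,3) by blast
  ultimately have "x \<in> common p r" using adjI x lp m by (auto simp: common_def)
  then show False using com x nla by auto
qed

lemma common_unique:
  assumes "p \<noteq> r" "\<not> adj p r" "a \<in> common p r" "b \<in> common p r"
  shows "a = b"
proof (rule ccontr)
  assume "a \<noteq> b"
  have V: "p \<in> V" "r \<in> V" "a \<in> V" "b \<in> V" using assms adj_V by (auto simp: common_def)
  have "{a, b} = common p r"
    using card_common_le_2[OF V(1,2) assms(1,2)] \<open>a \<noteq> b\<close> assms
    by (intro card_seteq) auto
  note com = this[symmetric]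
  interpret pair: nonadjacent_pair V adj p r "[a, b]"
  proof unfold_locales
    have "adj a b" using common_adjacent[OF assms \<open>a \<noteq> b\<close>] .
    then show "\<And>x y. \<lbrakk>x \<in> set [a, b]; y \<in> set [a, b]; x \<noteq> y\<rbrakk> \<Longrightarrow> adj x y"
      using adj_sym by auto
    show "\<And>x. x \<in> set [a, b] \<Longrightarrow> adj p x" "\<And>x. x \<in> set [a, b] \<Longrightarrow> adj r x"
      using assms(3,4) by (auto simp: common_def)
  qed (use V assms(1,2) \<open>a \<noteq> b\<close> in simp_all)
  \<comment> \<open>k >= 3 is just enough: 2 (6 - 2) = 8 private neighbours.\<close>
  have "3 * 2 \<le> k * (k - 1)" using k3 by (intro mult_le_mono) auto
  then have card: "8 \<le> card (adj.private_nbrs p r)"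
    using card_private(1)[OF V(1,2) assms(2)] \<open>a \<noteq> b\<close> by (simp add: com)
  define \<pi> where "\<pi> y = adj.sgn_adj p y * (adj.sgn_adj a y * adj.sgn_adj b y)" for y
  have par: "\<pi> u = \<pi> v" if "u \<in> adj.private_nbrs p r" "v \<in> adj.private_nbrs p r" for u v
    unfolding \<pi>_def by (rule pair.private_nbrs_parity(1)[OF refl card that])
  have same: "adj a u \<longleftrightarrow> adj a v" if "u \<in> adj.private_nbrs p r" "v \<in> adj.private_nbrs p r" "adj u v" for u v
    using pair.private_nbrs_parity(2)[OF refl card that]
    by (auto simp: adj.sgn_adj_def split: if_splits)
  have priv: "y \<in> adj.private_nbrs p r" if "adj p y \<and> \<not> adj r y \<or> adj r y \<and> \<not> adj p y" for y
    using that adj_V by (auto simp: adj.private_nbrs_def)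
  have pm: "\<pi> y = 1 \<or> \<pi> y = - 1" for y by (auto simp: \<pi>_def adj.sgn_adj_def)
  show False
  \<comment> \<open>On the side of \<open>r\<close> the factor \<open>sgn_adj p y\<close> is -1, so
    sign 1 makes the adjacencies to \<open>a\<close> and \<open>b\<close> differ there; sign -1 does
    so on the side of \<open>p\<close>. Either way one side is ruled out by
    \<open>odd_side_impossible\<close>.\<close>
  proof (cases "\<exists>y\<in>adj.private_nbrs p r. \<pi> y = 1")
    case True
    then have "\<pi> y = 1" if "y \<in> adj.private_nbrs p r" for y using par that by metis
    note \<pi>1 = this
    have "adj a y \<longleftrightarrow> \<not> adj b y" if "adj r y" "\<not> adj p y" for y
    proof -
      have "\<pi> y = 1" using \<pi>1 priv that by blast
      then show ?thesis using that by (simp add: \<pi>_def adj.sgn_adj_def split: if_splits)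
    qed
    moreover have "common r p = {a, b}" using com by (auto simp: common_def)
    ultimately show False
      using odd_side_impossible[of r p a b] V assms(1,2) adj_sym same priv by metis
  next
    case False
    then have "\<pi> y = - 1" if "y \<in> adj.private_nbrs p r" for y using pm that by metis
    note \<pi>m1 = this
    have "adj a y \<longleftrightarrow> \<not> adj b y" if "adj p y" "\<not> adj r y" for y
    proof -
      have "\<pi> y = - 1" using \<pi>m1 priv that by blast
      then show ?thesis using that by (simp add: \<pi>_def adj.sgn_adj_def split: if_splits)
    qed
    then show False
      using odd_side_impossible[of p r a b] V assms(1,2) com same priv by metis
  qed
qed

section \<open>Neighbourhoods in the distance-two graph are cliques\<close>

lemma exists_adjacent_across:
  assumes a: "a \<in> V"
  shows "\<exists>l1 l2 x1 x2. F l1 a \<and> F l2 a \<and> l1 \<noteq> l2 \<and> F l1 x1 \<and> F l2 x2 \<and> x1 \<noteq> a \<and> x2 \<noteq> a \<and> adj x1 x2"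
proof (rule ccontr)
  assume "\<not> ?thesis"
  then have none: "\<not> adj x1 x2" if "F l1 a" "F l2 a" "l1 \<noteq> l2" "F l1 x1" "F l2 x2" "x1 \<noteq> a" "x2 \<noteq> a" for l1 l2 x1 x2
    using that by blast
  obtain l1 where l1: "F a l1" using exists_neighbour[OF a, of a a] by blast
  obtain l2 where l2: "F a l2" "l2 \<noteq> l1" using exists_neighbour[OF a, of l1 l1] by blast
  obtain l3 where l3: "F a l3" "l3 \<noteq> l1" "l3 \<noteq> l2" using exists_neighbour[OF a, of l1 l2] by blast
  have two: "\<exists>b c. F l b \<and> F l c \<and> b \<noteq> a \<and> c \<noteq> a \<and> b \<noteq> c" if "F a l" for l
    using exists_neighbour[OF F_V2[OF that]] by metis
  obtain b1 c1 where 1: "F l1 b1" "F l1 c1" "b1 \<noteq> a" "c1 \<noteq> a" "b1 \<noteq> c1" using two[OF l1] by blast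
  obtain b2 c2 where 2: "F l2 b2" "F l2 c2" "b2 \<noteq> a" "c2 \<noteq> a" "b2 \<noteq> c2" using two[OF l2(1)] by blast
  obtain b3 c3 where 3: "F l3 b3" "F l3 c3" "b3 \<noteq> a" "c3 \<noteq> a" "b3 \<noteq> c3" using two[OF l3(1)] by blast
  have one: "gram adj u v = 1" if "F l u" "F l v" "u \<noteq> v" for l u v
    using adjI[OF that] that(3) by (simp add: gram_def)
  have zero: "gram adj u v = 0"
    if "F a l" "F a l'" "l \<noteq> l'" "F l u" "F l' v" "u \<noteq> a" "v \<noteq> a" for l l' u v
  proof -
    have "u \<noteq> v" using codegree_le_1[of l a u l'] F_sym that by metis
    moreover have "\<not> adj u v" using none[of l l' u v] F_sym that by metis
    ultimately show ?thesis by (simp add: gram_def)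
  qed
  have self: "gram adj u u = 2" for u by (simp add: gram_def)
  note Fa = F_sym[OF l1] F_sym[OF l2(1)] F_sym[OF l3(1)]
  have ga: "gram adj a u = 1" "gram adj u a = 1" if "u \<in> {b1, c1, b2, c2, b3, c3}" for u
    using one[OF Fa(1), of u] one[OF Fa(2), of u] one[OF Fa(3), of u] that 1 2 3 adj.gram_sym[of u a]
    by auto
  have gl: "gram adj b1 c1 = 1" "gram adj c1 b1 = 1" "gram adj b2 c2 = 1" "gram adj c2 b2 = 1"
    "gram adj b3 c3 = 1" "gram adj c3 b3 = 1"
    using one[OF 1(1,2)] one[OF 2(1,2)] one[OF 3(1,2)] one[OF 1(2,1)] one[OF 2(2,1)] one[OF 3(2,1)] 1 2 3
    by auto
  have g12: "gram adj u v = 0" "gram adj v u = 0" if "u \<in> {b1, c1}" "v \<in> {b2, c2}" for u v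
    using zero[OF l1 l2(1), of u v] l2 1 2 that adj.gram_sym[of v u] by auto
  have g13: "gram adj u v = 0" "gram adj v u = 0" if "u \<in> {b1, c1}" "v \<in> {b3, c3}" for u v
    using zero[OF l1 l3(1), of u v] l3 1 3 that adj.gram_sym[of v u] by auto
  have g23: "gram adj u v = 0" "gram adj v u = 0" if "u \<in> {b2, c2}" "v \<in> {b3, c3}" for u v
    using zero[OF l2(1) l3(1), of u v] l3 2 3 that adj.gram_sym[of v u] by auto
  \<comment> \<open>Three triangles sharing only \<open>a\<close>, with no further adjacencies, give
    norm 18 - 36 + 18 = 0.\<close>
  let ?xs = "[(3, a), (-1, b1), (-1, c1), (-1, b2), (-1, c2), (-1, b3), (-1, c3)]"
  have "lform adj ?xs ?xs = 0"
    by (simp add: lform_Cons_right self ga gl g12 g13 g23)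
  moreover have "0 < lform adj ?xs ?xs"
  proof (rule adj.pd[of _ a])
    show "snd ` set ?xs \<subseteq> V" using a 1 2 3 F_V2 by auto
  qed (use a 1 2 3 in auto)
  ultimately show False by simp
qed

text \<open>Otherwise \<open>a\<close> and \<open>y\<close> are two common neighbours of a
  nonadjacent pair. So the neighbourhood of \<open>a\<close> splits into cliques.\<close>

lemma adj_trans_at:
  assumes "adj a x" "adj a y" "adj a z" "adj x y" "adj y z" "x \<noteq> z"
  shows "adj x z"
proof (rule ccontr)
  assume "\<not> adj x z"
  moreover have "a \<in> common x z" "y \<in> common x z" unfolding common_def using assms adj_sym by blast+
  ultimately have "a = y" using common_unique[OF assms(6)] by blast
  then show False using assms(2) unfolding adj_def by blast
qed

text \<open>One adjacency between two lines through \<open>a\<close> spreads by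
  \<open>meets_all\<close>: a second line \<open>m\<close> through \<open>x1\<close> meets
  \<open>l2\<close>, so \<open>m\<close> avoids \<open>a\<close> but has two, and then only,
  neighbours of \<open>a\<close>. Hence every line through \<open>a\<close> meets \<open>m\<close>,
  which puts all neighbours of \<open>a\<close> into the clique of \<open>x1\<close>.\<close>

lemma neighbourhood_clique:
  assumes "adj a y" "adj a z" "y \<noteq> z"
  shows "adj y z"
proof -
  have "a \<in> V" using assms adj_V by blast
  then obtain l1 l2 x1 x2 where l: "F l1 a" "F l2 a" "l1 \<noteq> l2" "F l1 x1" "F l2 x2" "x1 \<noteq> a" "x2 \<noteq> a" "adj x1 x2"
    using exists_adjacent_across by metis
  have ax: "adj a x1" "adj a x2" using l adjI by blast+
  have l2all: "adj x1 t" if "F l2 t" for t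
  proof (cases "t = a \<or> t = x2")
    case True
    then show ?thesis using ax l(8) adj_sym by blast
  next
    case False
    then have "adj a t" "adj x2 t" using l that adjI by blast+
    moreover have "x1 \<noteq> t" using codegree_le_1[of l1 a x1 l2] l that by metis
    ultimately show ?thesis using adj_trans_at[of a x1 x2 t] ax l(8) by blast
  qed
  have nl2: "\<not> F l2 x1" using codegree_le_1[of l1 a x1 l2] l by metis
  obtain m where m: "F x1 m" "m \<noteq> l1"
    using exists_neighbour[of x1 l1 l1] adj_V ax by blast
  have mx: "F m x1" using m F_sym by blast
  obtain b where b: "F l2 b" "F m b"
    using meets_all[OF F_V[OF l(2)] nl2 l2all mx] by blast
  have nma: "\<not> F m a" using codegree_le_1[of l1 a x1 m] l m mx by metis
  then have "b \<noteq> a" using b by blast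
  then have ab: "adj a b" using adjI[OF l(2) b(1)] by blast
  have "x1 \<noteq> b" using nl2 b by blast
  have mall: "adj a t" if "F m t" for t
  proof (cases "t = x1 \<or> t = b")
    case True
    then show ?thesis using ax ab by blast
  next
    case False
    then have "adj t x1" "adj t b" using adjI[OF that] mx b by blast+
    moreover have "a \<noteq> t" using nma that by blast
    ultimately show ?thesis
      using common_unique[of a t x1 b] ax ab \<open>x1 \<noteq> b\<close> by (auto simp: common_def)
  qed
  have near: "t = x1 \<or> adj x1 t" if t: "adj a t" for t
  proof -
    obtain w where w: "F w a" "F w t" using t by (auto simp: adj_def)
    obtain u where u: "F m u" "F w u"
      using meets_all[OF F_V[OF mx] nma mall w(1)] by blast
    have au: "adj a u" using mall u by blast
    have "u = x1 \<or> adj x1 u" using adjI[OF mx u(1)] by blast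
    moreover have "u = t \<or> adj u t" using adjI[OF u(2) w(2)] by blast
    ultimately show ?thesis using adj_trans_at[of a x1 u t] ax au t by blast
  qed
  show ?thesis
  proof (cases "y = x1 \<or> z = x1")
    case True
    then show ?thesis using near[OF assms(1)] near[OF assms(2)] assms(3) adj_sym by blast
  next
    case False
    then have "adj y x1" "adj x1 z" using near assms adj_sym by blast+
    then show ?thesis using adj_trans_at[of a y x1 z] assms ax by blast
  qed
qed

lemma adj_if_same_side:
  assumes "F\<^sup>*\<^sup>* u v" "u \<in> S \<longleftrightarrow> v \<in> S" "u \<noteq> v"
  shows "adj u v"
proof -
  have trans: "u = w' \<or> adj u w'" if "u = w \<or> adj u w" "F v w" "F v w'" for v w w'
    using that adjI[OF that(2,3)] neighbourhood_clique[of w u w'] adj_sym by blast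
  have side: "u \<in> S \<longleftrightarrow> w \<in> S" if "u = w \<or> adj u w" for w
    using that bip unfolding adj_def by blast
  \<comment> \<open>The second alternative carries the induction through walk vertices on the
    opposite side.\<close>
  have "(u = v \<or> adj u v) \<or> (\<exists>w. F v w \<and> (u = w \<or> adj u w))"
    using assms(1)
  proof induction
    case (step v v')
    from step.IH show ?case
    proof (elim disjE exE)
      fix w assume "F v w \<and> (u = w \<or> adj u w)"
      then show ?thesis using trans[of w v v'] step.hyps(2) by blast
    qed (use F_sym[OF step.hyps(2)] in blast)+
  qed blast
  then show ?thesis
    using assms(2,3) side bip by blast
qed


section \<open>A quadrangle, and the spectrum when each side is complete\<close>

lemma quadrangle:
  assumes "u \<in> V"
  shows "\<exists>T. card T = 4 \<and> (\<forall>t\<in>T. t \<in> V \<and> (t \<in> S \<longleftrightarrow> u \<in> S)) \<and> (\<forall>l. card {t \<in> T. F l t} \<le> 2)"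
proof -
  obtain l1 where l1: "F u l1" using exists_neighbour[OF assms, of u u] by blast
  obtain l2 where l2: "F u l2" "l2 \<noteq> l1" using exists_neighbour[OF assms, of l1 l1] by blast
  have two: "\<exists>b c. F l b \<and> F l c \<and> b \<noteq> u \<and> c \<noteq> u \<and> b \<noteq> c" if "F u l" for l
    using exists_neighbour[OF F_V2[OF that]] by metis
  obtain a b where ab: "F l1 a" "F l1 b" "a \<noteq> u" "b \<noteq> u" "a \<noteq> b" using two[OF l1] by blast
  obtain c d where cd: "F l2 c" "F l2 d" "c \<noteq> u" "d \<noteq> u" "c \<noteq> d" using two[OF l2(1)] by blast
  have lu: "F l1 u" "F l2 u" using l1 l2 F_sym by blast+
  have n1: "\<not> F l2 a" "\<not> F l2 b" "\<not> F l1 c" "\<not> F l1 d"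
    using codegree_le_1[of l1 u _ l2] lu l2(2) ab cd by metis+
  have l1_eq: "l = l1" if "F l a" "F l b" for l
    by (rule codegree_le_1[OF that ab(1,2,5)])
  have l2_eq: "l = l2" if "F l c" "F l d" for l
    by (rule codegree_le_1[OF that cd(1,2,5)])
  \<comment> \<open>Two points other than \<open>u\<close> on each of two lines through
    \<open>u\<close>: a line containing three of them would be one of these two lines, which misses
    the other pair.\<close>
  let ?T = "{a, b, c, d}"
  have "card {t \<in> ?T. F l t} \<le> 2" for l
  proof -
    have "\<exists>x y. {t \<in> ?T. F l t} \<subseteq> {x, y}"
    proof (cases "(F l a \<and> F l b) \<or> (F l c \<and> F l d)")
      case True
      then have "l = l1 \<or> l = l2" using l1_eq l2_eq by blast
      then have "{t \<in> ?T. F l t} \<subseteq> {a, b} \<or> {t \<in> ?T. F l t} \<subseteq> {c, d}" using n1 by blast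
      then show ?thesis by blast
    next
      case False
      then have "{t \<in> ?T. F l t} \<subseteq> {if F l a then a else b, if F l c then c else d}" by auto
      then show ?thesis by blast
    qed
    then obtain x y where "{t \<in> ?T. F l t} \<subseteq> {x, y}" by blast
    then have "card {t \<in> ?T. F l t} \<le> card {x, y}" by (intro card_mono) auto
    also have "\<dots> \<le> 2" by (simp add: card_insert_if)
    finally show ?thesis .
  qed
  moreover have "a \<noteq> c" "a \<noteq> d" "b \<noteq> c" "b \<noteq> d" using n1 ab cd by metis+
  then have "card ?T = 4" using ab cd by simp
  moreover have "t \<in> V \<and> (t \<in> S \<longleftrightarrow> u \<in> S)" if "t \<in> ?T" for t
    using that ab cd lu F_V2 bip by blast
  ultimately show ?thesis by blast
qed

text \<open>The test vector e_p - e_q bounds the index from above: the neighbourhoods of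
  \<open>p\<close> and \<open>q\<close> share one vertex, where the contributions cancel.\<close>

lemma pair_difference_norm:
  assumes "adj p q"
  shows "\<exists>y :: 'a \<Rightarrow> real. (\<Sum>v\<in>V. (y v)\<^sup>2) = 2 \<and> (\<Sum>u\<in>V. (\<Sum>v | F u v. y v)\<^sup>2) = 2 * (real k - 1)"
proof -
  define y where "y v = of_bool (v = p) - (of_bool (v = q) :: real)" for v
  have pq: "p \<in> V" "q \<in> V" "p \<noteq> q" using assms adj_V by (auto simp: adj_def)
  have "(\<Sum>v\<in>V. (y v)\<^sup>2) = (\<Sum>v\<in>V. of_bool (v = p) + of_bool (v = q))"
    by (intro sum.cong) (use pq in \<open>auto simp: y_def\<close>)
  then have 1: "(\<Sum>v\<in>V. (y v)\<^sup>2) = 2" using pq fin by (simp add: sum.distrib of_bool_def)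
  have Nsum: "(\<Sum>u\<in>V. of_bool (F u v)) = real k" if "v \<in> V" for v
  proof -
    have "{u \<in> V. F u v} = N v" using F_V F_sym by blast
    then show ?thesis using deg[OF that] fin by (simp add: of_bool_def sum.If_cases Int_def)
  qed
  obtain w where w: "F w p" "F w q" using assms by (auto simp: adj_def)
  have "(\<Sum>u\<in>V. (\<Sum>v | F u v. y v)\<^sup>2) = (\<Sum>u\<in>V. of_bool (F u p) + of_bool (F u q) - 2 * of_bool (u = w))"
  proof (intro sum.cong refl)
    fix u
    have "(\<Sum>v | F u v. y v) = of_bool (F u p) - of_bool (F u q)"
      by (simp add: y_def sum_subtractf of_bool_def)
    moreover have "u = w \<longleftrightarrow> F u p \<and> F u q" using codegree_le_1[OF _ _ w pq(3)] w by blast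
    ultimately show "(\<Sum>v | F u v. y v)\<^sup>2 = of_bool (F u p) + of_bool (F u q) - 2 * of_bool (u = w)"
      by auto
  qed
  also have "\<dots> = 2 * (real k - 1)"
    using Nsum pq F_V[OF w(1)] fin
    by (simp add: sum.distrib sum_subtractf sum_distrib_left[symmetric])
  finally show ?thesis using 1 by blast
qed

text \<open>On each side the square of the adjacency operator is (k - 1) I + J.\<close>

lemma eigenvalue_square:
  assumes all: "\<And>u v. u \<in> V \<Longrightarrow> v \<in> V \<Longrightarrow> (u \<in> S \<longleftrightarrow> v \<in> S) \<Longrightarrow> u \<noteq> v \<Longrightarrow> adj u v"
    and y: "\<exists>v\<in>V. y v \<noteq> 0" "\<And>u. u \<in> V \<Longrightarrow> (\<Sum>v | F u v. y v) = \<rho> * y u"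
    and le: "\<rho>\<^sup>2 \<le> real k - 1"
  shows "\<rho>\<^sup>2 = real k - 1"
proof -
  obtain u where u: "u \<in> V" "y u \<noteq> 0" using y(1) by blast
  define side where "side = {v \<in> V. v \<in> S \<longleftrightarrow> u \<in> S}"
  have side: "finite side" "u \<in> side" using fin u by (auto simp: side_def)
  have eq: "(\<rho>\<^sup>2 - (real k - 1)) * y t = (\<Sum>v\<in>side. y v)" if t: "t \<in> side" for t
  proof -
    have tV: "t \<in> V" using t by (simp add: side_def)
    have cd: "real (card (N t \<inter> N v)) = (if v = t then real k - 1 else 0) + (if v \<in> side then 1 else 0)"
      if v: "v \<in> V" for v
    proof -
      have "adj t v \<longleftrightarrow> t \<noteq> v \<and> v \<in> side"
      proof
        assume "adj t v"
        then show "t \<noteq> v \<and> v \<in> side" using bip t v unfolding adj_def side_def by blast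
      qed (use all t v in \<open>auto simp: side_def\<close>)
      then show ?thesis using codegree_gram[OF tV, of v] t by (auto simp: gram_def split: if_splits)
    qed
    have "\<rho>\<^sup>2 * y t = (\<Sum>w | F t w. \<rho> * y w)"
      using y(2)[OF tV] by (simp add: sum_distrib_left[symmetric] power2_eq_square)
    also have "\<dots> = (\<Sum>w | F t w. \<Sum>v | F w v. y v)"
      by (intro sum.cong) (use y(2) F_V2 in auto)
    also have "\<dots> = (\<Sum>w | F t w. \<Sum>v\<in>V. if F w v then y v else 0)"
      using F_V2 fin by (intro sum.cong refl sum.mono_neutral_cong_left) auto
    also have "\<dots> = (\<Sum>v\<in>V. \<Sum>w | F t w. if F w v then y v else 0)" by (rule sum.swap)
    also have "\<dots> = (\<Sum>v\<in>V. real (card (N t \<inter> N v)) * y v)"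
    proof (intro sum.cong refl)
      fix v
      have "{w. F t w} \<inter> {w. F w v} = N t \<inter> N v" using F_sym by blast
      then show "(\<Sum>w | F t w. if F w v then y v else 0) = real (card (N t \<inter> N v)) * y v"
        by (simp add: sum.If_cases)
    qed
    also have "\<dots> = (\<Sum>v\<in>V. (if v = t then (real k - 1) * y t else 0) + (if v \<in> side then y v else 0))"
      by (intro sum.cong refl) (auto simp: cd distrib_right)
    also have "\<dots> = (real k - 1) * y t + (\<Sum>v\<in>side. y v)"
    proof -
      have "V \<inter> side = side" by (auto simp: side_def)
      then show ?thesis using fin tV by (simp add: sum.distrib sum.If_cases)
    qed
    finally show ?thesis by (simp add: algebra_simps)
  qed
  \<comment> \<open>Sum of \<open>eq\<close> over the side. The left factor is at most 0 and the
    side is nonempty, so the sum of \<open>y\<close> vanishes.\<close>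
  have "(\<rho>\<^sup>2 - (real k - 1)) * (\<Sum>v\<in>side. y v) = real (card side) * (\<Sum>v\<in>side. y v)"
  proof -
    have "(\<rho>\<^sup>2 - (real k - 1)) * (\<Sum>v\<in>side. y v) = (\<Sum>t\<in>side. \<Sum>v\<in>side. y v)"
      unfolding sum_distrib_left by (intro sum.cong refl) (rule eq)
    then show ?thesis by simp
  qed
  moreover have "real (card side) > 0" using side by (auto simp: card_gt_0_iff)
  ultimately have "(\<Sum>v\<in>side. y v) = 0" using le by auto
  then show ?thesis using eq[OF side(2)] u(2) by simp
qed

end

section \<open>Transfer to the given graph\<close>

theorem theorem2p1:
  fixes n k :: nat and E :: "nat \<Rightarrow> nat \<Rightarrow> bool"
  assumes "simple_graph n E" and "connected_graph n E" and "bipartite_graph n E"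
    and "regular_graph n E k" and "k \<ge> 3"
    and "HL_index n E > sqrt (real k - 2)"
  shows "HL_index n E = sqrt (real k - 1) \<and> is_incidence_graph_of_projective_plane n E (k - 1)"
proof -
  let ?A = "adjacency_matrix n E" and ?V = "{..<n}"
  \<comment> \<open>\<open>E\<close> is arbitrary outside the first \<open>n\<close> vertices, so it
    is cut off there.\<close>
  define F where "F u v \<longleftrightarrow> u < n \<and> v < n \<and> E u v" for u v
  define R where "R = HL_index n E"
  have n: "0 < n" using assms(2) by (simp add: connected_graph_def)
  obtain S where S: "\<forall>u<n. \<forall>v<n. E u v \<longrightarrow> (u \<in> S \<longleftrightarrow> v \<notin> S)"
    using assms(3) unfolding bipartite_graph_def by blast
  have A: "?A \<in> carrier_mat n n" by (simp add: adjacency_matrix_def)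
  have sym: "?A $$ (i, j) = ?A $$ (j, i)" if "i < n" "j < n" for i j
    using assms(1) that by (auto simp: adjacency_matrix_def simple_graph_def)
  have row: "(\<Sum>j<n. ?A $$ (u, j) * x j) = (\<Sum>v | F u v. x v)" if "u < n" for u x
  proof -
    have "(\<Sum>j<n. ?A $$ (u, j) * x j) = (\<Sum>j<n. if F u j then x j else 0)"
      by (intro sum.cong) (use that in \<open>auto simp: adjacency_matrix_def F_def\<close>)
    also have "\<dots> = (\<Sum>v | F u v. x v)"
      by (intro sum.mono_neutral_cong_right) (auto simp: F_def)
    finally show ?thesis .
  qed
  have Rpos: "0 < R" and Rsq: "real k - 2 < R\<^sup>2"
  proof -
    have "0 \<le> sqrt (real k - 2)" using assms(5) by simp
    then show "0 < R" using assms(6) unfolding R_def by linarith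
    have "(sqrt (real k - 2))\<^sup>2 < R\<^sup>2"
      using assms(5,6) unfolding R_def by (intro power_strict_mono) auto
    then show "real k - 2 < R\<^sup>2" using assms(5) by simp
  qed
  note HL = HL_index_eigenvalue[OF assms(1,3) n Rpos[unfolded R_def], folded R_def]
  have low: "R\<^sup>2 * (\<Sum>v<n. (x v)\<^sup>2) \<le> (\<Sum>u<n. (\<Sum>v | F u v. x v)\<^sup>2)" for x
    using symmetric_norm_lower_bound[OF n A sym _ HL(2), of x] Rpos by (simp add: row)
  interpret pd_regular_graph ?V F k S
  proof
    show "F u v \<Longrightarrow> u \<in> ?V" "F u v \<Longrightarrow> u \<in> S \<longleftrightarrow> v \<notin> S" for u v
      using S by (auto simp: F_def)
    show "F u v \<Longrightarrow> F v u" for u v using assms(1) by (auto simp: F_def simple_graph_def)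
    show "card {u. F v u} = k" if "v \<in> ?V" for v
    proof -
      have "{u. F v u} = {u. u < n \<and> E v u}" using that by (auto simp: F_def)
      then show ?thesis using assms(4) that by (simp add: regular_graph_def)
    qed
    fix x :: "nat \<Rightarrow> real" assume "\<exists>v\<in>?V. x v \<noteq> 0"
    then have "0 < (\<Sum>v<n. (x v)\<^sup>2)" by (auto intro!: sum_pos2)
    then have "(real k - 2) * (\<Sum>v<n. (x v)\<^sup>2) < R\<^sup>2 * (\<Sum>v<n. (x v)\<^sup>2)" using Rsq by simp
    then show "(real k - 2) * (\<Sum>v<n. (x v)\<^sup>2) < (\<Sum>u<n. (\<Sum>v | F u v. x v)\<^sup>2)" using low[of x] by linarith
  qed (use assms(5) in auto)
  have all: "adj u v" if "u \<in> ?V" "v \<in> ?V" "u \<in> S \<longleftrightarrow> v \<in> S" "u \<noteq> v" for u v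
  proof (rule adj_if_same_side[OF _ that(3,4)])
    show "F\<^sup>*\<^sup>* u v" using assms(2) that(1,2) unfolding connected_graph_def F_def by simp
  qed
  \<comment> \<open>A walk of length two from 0 supplies the pair for the test vector and an edge
    that meets both sides.\<close>
  obtain l where l: "F 0 l" using exists_neighbour[of 0 0 0] n by blast
  obtain q where q: "F l q" "q \<noteq> 0" using exists_neighbour[of l 0 0] F_V2[OF l] by blast
  have "R = sqrt (real k - 1)"
  proof -
    have "adj 0 q" using adjI[OF F_sym[OF l] q(1)] q(2) by simp
    then obtain y where "(\<Sum>v<n. (y v)\<^sup>2) = 2" "(\<Sum>u<n. (\<Sum>v | F u v. y v)\<^sup>2) = 2 * (real k - 1)"
      using pair_difference_norm by blast
    then have le: "R\<^sup>2 \<le> real k - 1" using low[of y] by simp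
    obtain \<rho> where \<rho>: "eigenvalue ?A \<rho>" "\<bar>\<rho>\<bar> = R" using HL(1) by blast
    then obtain y where y: "\<exists>i<n. y i \<noteq> 0" "\<And>i. i < n \<Longrightarrow> (\<Sum>j<n. ?A $$ (i, j) * y j) = \<rho> * y i"
      unfolding eigenvalue_iff_function[OF A] by blast
    have "\<rho>\<^sup>2 = R\<^sup>2" using \<rho>(2) by (metis power2_abs)
    then have "\<rho>\<^sup>2 = real k - 1"
      using le y by (intro eigenvalue_square[OF all, of y]) (auto simp: row)
    then show ?thesis using \<open>\<rho>\<^sup>2 = R\<^sup>2\<close> Rpos by (simp add: real_sqrt_unique)
  qed
  moreover have "is_incidence_graph_of_projective_plane n E (k - 1)"
  proof -
    define P L where "P = {v. v < n \<and> v \<in> S}" and "L = {v. v < n \<and> v \<notin> S}"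
    have EF: "E p l \<longleftrightarrow> F l p" if "p \<in> P" "l \<in> L" for p l
      using that assms(1) by (simp add: P_def L_def F_def simple_graph_def)
    have points: "\<exists>!w. w \<in> L \<and> E p w \<and> E q w" if pq: "p \<in> P" "q \<in> P" "p \<noteq> q" for p q
    proof -
      have "adj p q" using pq by (intro all) (auto simp: P_def)
      then obtain w where w: "F w p" "F w q" by (auto simp: adj_def)
      then have "w \<in> L" using bip[OF w(1)] pq by (auto simp: F_def L_def P_def)
      then show ?thesis using w EF pq codegree_le_1[OF _ _ w pq(3)] by blast
    qed
    have lines: "\<exists>!w. w \<in> P \<and> E w p \<and> E w q" if pq: "p \<in> L" "q \<in> L" "p \<noteq> q" for p q
    proof -
      have "adj p q" using pq by (intro all) (auto simp: L_def)
      then obtain w where w: "F w p" "F w q" by (auto simp: adj_def)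
      then have "w \<in> P" using bip[OF w(1)] pq by (auto simp: F_def L_def P_def)
      then show ?thesis using w EF pq codegree_le_1[OF _ _ w pq(3)] F_sym by blast
    qed
    have quad: "\<exists>T\<subseteq>P. card T = 4 \<and> (\<forall>l\<in>L. card {p \<in> T. E p l} \<le> 2)"
    proof -
      have "\<exists>u\<in>?V. u \<in> S" using bip[OF l] F_V[OF l] F_V2[OF l] by blast
      then obtain u where "u \<in> ?V" "u \<in> S" by blast
      then obtain T where T: "card T = 4" "\<forall>t\<in>T. t \<in> ?V \<and> (t \<in> S \<longleftrightarrow> u \<in> S)" "\<forall>l. card {t \<in> T. F l t} \<le> 2"
        using quadrangle by blast
      then have "T \<subseteq> P" using \<open>u \<in> S\<close> by (auto simp: P_def)
      moreover have "{p \<in> T. E p l} = {p \<in> T. F l p}" if "l \<in> L" for l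
        using EF that \<open>T \<subseteq> P\<close> by blast
      ultimately show ?thesis using T by auto
    qed
    have line_card: "card {p \<in> P. E p l} = k - 1 + 1" if "l \<in> L" for l
    proof -
      have "{p \<in> P. E p l} = {u. F l u}"
      proof
        show "{u. F l u} \<subseteq> {p \<in> P. E p l}"
        proof
          fix u assume "u \<in> {u. F l u}"
          then have "F l u" "u \<in> P" using that bip[of l u] by (auto simp: F_def P_def L_def)
          then show "u \<in> {p \<in> P. E p l}" using EF[OF _ that] by simp
        qed
      qed (use EF that in blast)
      then show ?thesis using deg[of l] that k3 by (simp add: L_def)
    qed
    have plane: "projective_plane_of_order P L E (k - 1)"
      unfolding projective_plane_of_order_def projective_plane_def
      by (intro conjI ballI impI points lines quad line_card) (assumption | simp add: P_def L_def)+
    define f :: "nat \<Rightarrow> nat + nat" where "f v = (if v \<in> S then Inl v else Inr v)" for v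
    have "bij_betw f {0..<n} (Inl ` P \<union> Inr ` L)"
      by (rule bij_betwI[where g = "case_sum id id"]) (auto simp: f_def P_def L_def)
    moreover have "E u v \<longleftrightarrow> incidence_adj E (f u) (f v)" if "u < n" "v < n" for u v
    proof -
      have "E u v \<longrightarrow> (u \<in> S \<longleftrightarrow> v \<notin> S)" "E v u \<longleftrightarrow> E u v"
        using S that assms(1) unfolding simple_graph_def by blast+
      then show ?thesis by (auto simp: f_def)
    qed
    ultimately show ?thesis
      unfolding is_incidence_graph_of_projective_plane_def using plane by blast
  qed
  ultimately show ?thesis by (simp add: R_def)
qed

end
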